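(* Let $A\subseteq R\subseteq S$ be commutative rings and let $f\in R$. Suppose that $R$ is a direct summand of $S$ as an $R$-module and that the inclusion $R\subseteq S$ is differentially extensible over $A$. If the Bernstein–Sato polynomial $b^{S|A}_f(s)$ exists, then $b^{R|A}_f(s)$ exists and $b^{R|A}_f(s)=b^{S|A}_f(s)$.
   Context: Differential operators: $D^0_{R|A}=\operatorname{Hom}_R(R,R)$, $D^n_{R|A}=\{\delta\in\operatorname{Hom}_A(R,R) : [\delta,r]\in D^{n-1}_{R|A}\ \forall r\in R\}$, $D_{R|A}=\bigcup_nD^n_{R|A}$; likewise for $S$. Differentially extensible: the inclusion $R\subseteq S$ of $A$-algebras is differentially extensible over $A$ if for every $\delta\in D_{R|A}$ there is $\tilde\delta\in D_{S|A}$ with $\tilde\delta|_R=\delta$. Bernstein–Sato polynomial: for a ring $R$, a subring $A$, and $f\in R$, a polynomial $b^{R|A}_f(s)\in A[s]$ is the Bernstein–Sato polynomial of $f$ if it is monic; there exists $\delta\in D_{R|A}$ such that, with $b=b^{R|A}_f$, $$\delta\cdot f^{t+1}=b(t)f^t\quad\text{for all } t\in\mathbb Z;\qquad(\dagger)$$ and for any pair $\delta\in D_{R|A}$, $b\in A[s]$ satisfying $(\dagger)$, $b^{R|A}_f(s)$ divides $b$. If no $\delta$ and nonzero $b$ satisfy $(\dagger)$, then $f$ has no Bernstein–Sato polynomial. For negative exponents, $(\dagger)$ is read in the localization $R_f$, to which operators in $D_{R|A}$ extend (uniquely) as $A$-linear differential operators. *)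

theory Defs
  imports "HOL-Algebra.Algebra"
begin

section \<open>Differential operators\<close>

text \<open>
  Endomorphisms of a ring are represented as extensional functions, so that equality of functions
  is equality of maps on the carrier. The algebra structure is given by a subset \<open>K\<close> of the
  carrier of \<open>R\<close>, the image of the base ring in \<open>R\<close>.
\<close>

definition linear_endos :: "('a, 'm) ring_scheme \<Rightarrow> 'a set \<Rightarrow> ('a \<Rightarrow> 'a) set" where
  "linear_endos R K =
    {\<phi> \<in> carrier R \<rightarrow>\<^sub>E carrier R.
      (\<forall>x \<in> carrier R. \<forall>y \<in> carrier R. \<phi> (x \<oplus>\<^bsub>R\<^esub> y) = \<phi> x \<oplus>\<^bsub>R\<^esub> \<phi> y) \<and>
      (\<forall>a \<in> K. \<forall>x \<in> carrier R. \<phi> (a \<otimes>\<^bsub>R\<^esub> x) = a \<otimes>\<^bsub>R\<^esub> \<phi> x)}"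

definition commutator :: "('a, 'm) ring_scheme \<Rightarrow> ('a \<Rightarrow> 'a) \<Rightarrow> 'a \<Rightarrow> ('a \<Rightarrow> 'a)" where
  "commutator R \<delta> r = (\<lambda>x \<in> carrier R. \<delta> (r \<otimes>\<^bsub>R\<^esub> x) \<ominus>\<^bsub>R\<^esub> r \<otimes>\<^bsub>R\<^esub> \<delta> x)"

primrec diff_ops_upto :: "('a, 'm) ring_scheme \<Rightarrow> 'a set \<Rightarrow> nat \<Rightarrow> ('a \<Rightarrow> 'a) set" where
  "diff_ops_upto R K 0 = linear_endos R (carrier R)"
| "diff_ops_upto R K (Suc n) =
    {\<delta> \<in> linear_endos R K. \<forall>r \<in> carrier R. commutator R \<delta> r \<in> diff_ops_upto R K n}"

definition diff_ops :: "('a, 'm) ring_scheme \<Rightarrow> 'a set \<Rightarrow> ('a \<Rightarrow> 'a) set" where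
  "diff_ops R K = (\<Union>n. diff_ops_upto R K n)"

definition differentially_extensible ::
    "('a, 'm) ring_scheme \<Rightarrow> 'a set \<Rightarrow> 'a set \<Rightarrow> bool" where
  "differentially_extensible S R A \<longleftrightarrow>
    (\<forall>\<delta> \<in> diff_ops (S\<lparr>carrier := R\<rparr>) A. \<exists>\<delta>' \<in> diff_ops S A. restrict \<delta>' R = \<delta>)"


section \<open>Direct summands\<close>

definition direct_summand ::
    "('r, 'm) ring_scheme \<Rightarrow> ('r, 'a, 'n) module_scheme \<Rightarrow> 'a set \<Rightarrow> bool" where
  "direct_summand R M H \<longleftrightarrow> submodule H R M \<and>
    (\<exists>N. submodule N R M \<and> H \<inter> N = {\<zero>\<^bsub>M\<^esub>} \<and> H <+>\<^bsub>M\<^esub> N = carrier M)"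

definition overring_module :: "('a, 'm) ring_scheme \<Rightarrow> ('a, 'a) module" where
  "overring_module S =
    \<lparr>carrier = carrier S, monoid.mult = monoid.mult S, one = monoid.one S, ring.zero = ring.zero S,
     ring.add = ring.add S,
     smult = monoid.mult S\<rparr>"


section \<open>Localization at the powers of an element\<close>

text \<open>
  The pair \<open>(r, m)\<close> stands for the fraction with numerator \<open>r\<close> and denominator
  \<open>f [^] m\<close>. Since \<open>f\<close> may be a zero divisor, the usual factor \<open>f [^] k\<close> is needed in the
  equivalence of fractions.
\<close>

definition fraction_rel ::
    "('a, 'm) ring_scheme \<Rightarrow> 'a \<Rightarrow> (('a \<times> nat) \<times> ('a \<times> nat)) set" where
  "fraction_rel R f =
    {((r, m), (r', m')). r \<in> carrier R \<and> r' \<in> carrier R \<and>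
      (\<exists>k::nat. f [^]\<^bsub>R\<^esub> k \<otimes>\<^bsub>R\<^esub> (r \<otimes>\<^bsub>R\<^esub> f [^]\<^bsub>R\<^esub> m') =
                f [^]\<^bsub>R\<^esub> k \<otimes>\<^bsub>R\<^esub> (r' \<otimes>\<^bsub>R\<^esub> f [^]\<^bsub>R\<^esub> m))}"

definition fraction :: "('a, 'm) ring_scheme \<Rightarrow> 'a \<Rightarrow> 'a \<Rightarrow> nat \<Rightarrow> ('a \<times> nat) set" where
  "fraction R f r m = fraction_rel R f `` {(r, m)}"

definition localization :: "('a, 'm) ring_scheme \<Rightarrow> 'a \<Rightarrow> ('a \<times> nat) set ring" where
  "localization R f =
    \<lparr>carrier = (carrier R \<times> UNIV) // fraction_rel R f,
     monoid.mult = (\<lambda>U V. \<Union>(r, m) \<in> U. \<Union>(r', m') \<in> V. fraction R f (r \<otimes>\<^bsub>R\<^esub> r') (m + m')),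
     monoid.one = fraction R f \<one>\<^bsub>R\<^esub> 0,
     ring.zero = fraction R f \<zero>\<^bsub>R\<^esub> 0,
     ring.add = (\<lambda>U V. \<Union>(r, m) \<in> U. \<Union>(r', m') \<in> V.
       fraction R f (r \<otimes>\<^bsub>R\<^esub> f [^]\<^bsub>R\<^esub> m' \<oplus>\<^bsub>R\<^esub> r' \<otimes>\<^bsub>R\<^esub> f [^]\<^bsub>R\<^esub> m) (m + m'))\<rparr>"

abbreviation to_loc :: "('a, 'm) ring_scheme \<Rightarrow> 'a \<Rightarrow> 'a \<Rightarrow> ('a \<times> nat) set" where
  "to_loc R f r \<equiv> fraction R f r 0"

definition loc_extension ::
    "('a, 'm) ring_scheme \<Rightarrow> 'a set \<Rightarrow> 'a \<Rightarrow> ('a \<Rightarrow> 'a) \<Rightarrow>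
      (('a \<times> nat) set \<Rightarrow> ('a \<times> nat) set) \<Rightarrow> bool" where
  "loc_extension R A f \<delta> \<delta>' \<longleftrightarrow>
    \<delta>' \<in> diff_ops (localization R f) (to_loc R f ` A) \<and>
    (\<forall>r \<in> carrier R. \<delta>' (to_loc R f r) = to_loc R f (\<delta> r))"


context cring begin

lemma equiv_fraction_rel:
  assumes f: "f \<in> carrier R"
  shows "equiv (carrier R \<times> UNIV) (fraction_rel R f)"
proof (rule equivI)
  show "fraction_rel R f \<subseteq> (carrier R \<times> UNIV) \<times> (carrier R \<times> UNIV)"
    by (auto simp: fraction_rel_def)
  show "refl_on (carrier R \<times> UNIV) (fraction_rel R f)"
    by (auto simp: fraction_rel_def refl_on_def)
  show "sym (fraction_rel R f)" unfolding fraction_rel_def sym_def by (auto; metis)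
  show "trans (fraction_rel R f)"
  proof (rule transI, clarify)
    fix a i b j c k
    assume "((a,i),(b,j)) \<in> fraction_rel R f" "((b,j),(c,k)) \<in> fraction_rel R f"
    then obtain p q :: nat where h: "a \<in> carrier R" "b \<in> carrier R" "c \<in> carrier R"
      "f [^] p \<otimes> (a \<otimes> f [^] j) = f [^] p \<otimes> (b \<otimes> f [^] i)"
      "f [^] q \<otimes> (b \<otimes> f [^] k) = f [^] q \<otimes> (c \<otimes> f [^] j)"
      by (auto simp: fraction_rel_def)
    have "f [^] (p+q+j) \<otimes> (a \<otimes> f [^] k) = (f [^] p \<otimes> (a \<otimes> f [^] j)) \<otimes> (f [^] q \<otimes> f [^] k)"
      using f h(1-3) by (simp add: nat_pow_mult[symmetric] m_ac)
    also have "\<dots> = (f [^] q \<otimes> (b \<otimes> f [^] k)) \<otimes> (f [^] p \<otimes> f [^] i)"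
      unfolding h(4) using f h(1-3) by (simp add: m_ac)
    also have "\<dots> = f [^] (p+q+j) \<otimes> (c \<otimes> f [^] i)"
      unfolding h(5) using f h(1-3) by (simp add: nat_pow_mult[symmetric] m_ac)
    finally show "((a,i),(c,k)) \<in> fraction_rel R f" using h by (auto simp: fraction_rel_def)
  qed
qed

lemma fraction_eq_iff:
  assumes f: "f \<in> carrier R" "a \<in> carrier R" "b \<in> carrier R"
  shows "fraction R f a i = fraction R f b j \<longleftrightarrow>
    (\<exists>k::nat. f [^] k \<otimes> (a \<otimes> f [^] j) = f [^] k \<otimes> (b \<otimes> f [^] i))"
  unfolding fraction_def using eq_equiv_class_iff[OF equiv_fraction_rel[OF f(1)], of "(a,i)" "(b,j)"] f
  by (auto simp: fraction_rel_def)

lemma fraction_mult: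
  assumes f: "f \<in> carrier R" "a \<in> carrier R" "b \<in> carrier R"
  shows "fraction R f a i \<otimes>\<^bsub>localization R f\<^esub> fraction R f b j = fraction R f (a \<otimes> b) (i + j)"
proof -
  have "(\<lambda>(r, m) (r', m'). fraction R f (r \<otimes> r') (m + m')) respects2 (fraction_rel R f)"
  proof (rule congruent2_commuteI[OF equiv_fraction_rel[OF f(1)]], goal_cases)
    case (1 y z) then show ?case by (auto simp: m_comm add.commute split: prod.splits)
  next
    case (2 y z w)
    obtain r m r' m' s n where e: "y = (r,m)" "z = (r',m')" "w = (s,n)" by (metis surj_pair)
    from 2 e obtain k :: nat where h: "r \<in> carrier R" "r' \<in> carrier R" "s \<in> carrier R"
      "f [^] k \<otimes> (r \<otimes> f [^] m') = f [^] k \<otimes> (r' \<otimes> f [^] m)"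
      by (auto simp: fraction_rel_def)
    have "f [^] k \<otimes> ((s \<otimes> r) \<otimes> f [^] (n + m')) = (f [^] k \<otimes> (r \<otimes> f [^] m')) \<otimes> (s \<otimes> f [^] n)"
      using f h(1-3) by (simp add: nat_pow_mult[symmetric] m_ac)
    also have "\<dots> = f [^] k \<otimes> ((s \<otimes> r') \<otimes> f [^] (n + m))"
      unfolding h(4) using f h(1-3) by (simp add: nat_pow_mult[symmetric] m_ac)
    finally show ?case using e h f by (auto simp: fraction_eq_iff)
  qed
  from UN_equiv_class2[OF equiv_fraction_rel[OF f(1)] equiv_fraction_rel[OF f(1)] this, of "(a,i)" "(b,j)"]
  show ?thesis using f by (simp add: localization_def fraction_def split_def)
qed

lemma fraction_add:
  assumes f: "f \<in> carrier R" "a \<in> carrier R" "b \<in> carrier R"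
  shows "fraction R f a i \<oplus>\<^bsub>localization R f\<^esub> fraction R f b j =
    fraction R f (a \<otimes> f [^] j \<oplus> b \<otimes> f [^] i) (i + j)"
proof -
  have "(\<lambda>(r, m) (r', m'). fraction R f (r \<otimes> f [^] m' \<oplus> r' \<otimes> f [^] m) (m + m'))
      respects2 (fraction_rel R f)"
  proof (rule congruent2_commuteI[OF equiv_fraction_rel[OF f(1)]], goal_cases)
    case (1 y z) then show ?case using f by (auto simp: a_comm add.commute split: prod.splits)
  next
    case (2 y z w)
    obtain r m r' m' s n where e: "y = (r,m)" "z = (r',m')" "w = (s,n)" by (metis surj_pair)
    from 2 e obtain k :: nat where h: "r \<in> carrier R" "r' \<in> carrier R" "s \<in> carrier R"
      "f [^] k \<otimes> (r \<otimes> f [^] m') = f [^] k \<otimes> (r' \<otimes> f [^] m)"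
      by (auto simp: fraction_rel_def)
    let ?c = "f [^] k \<otimes> (s \<otimes> (f [^] m \<otimes> (f [^] n \<otimes> f [^] m')))"
    have "f [^] k \<otimes> ((s \<otimes> f [^] m \<oplus> r \<otimes> f [^] n) \<otimes> f [^] (n + m')) =
        ?c \<oplus> (f [^] k \<otimes> (r \<otimes> f [^] m')) \<otimes> (f [^] n \<otimes> f [^] n)"
      using f h(1-3) by (simp add: nat_pow_mult[symmetric] m_ac l_distr r_distr)
    also have "\<dots> = f [^] k \<otimes> ((s \<otimes> f [^] m' \<oplus> r' \<otimes> f [^] n) \<otimes> f [^] (n + m))"
      unfolding h(4) using f h(1-3) by (simp add: nat_pow_mult[symmetric] m_ac l_distr r_distr)
    finally show ?case using e h f by (auto simp: fraction_eq_iff)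
  qed
  from UN_equiv_class2[OF equiv_fraction_rel[OF f(1)] equiv_fraction_rel[OF f(1)] this, of "(a,i)" "(b,j)"]
  show ?thesis using f by (simp add: localization_def fraction_def split_def)
qed

lemma fraction_cases:
  assumes "x \<in> carrier (localization R f)"
  obtains r m where "r \<in> carrier R" "x = fraction R f r m"
  using assms by (auto simp: localization_def fraction_def elim!: quotientE)

lemma fraction_closed:
  "a \<in> carrier R \<Longrightarrow> fraction R f a i \<in> carrier (localization R f)"
  by (auto simp: localization_def fraction_def intro!: quotientI)

lemma cring_localization:
  assumes f: "f \<in> carrier R"
  shows "cring (localization R f)"
proof -
  let ?L = "localization R f"
  have o: "\<one>\<^bsub>?L\<^esub> = fraction R f \<one> 0" "\<zero>\<^bsub>?L\<^esub> = fraction R f \<zero> 0" by (auto simp: localization_def)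
  note s = fraction_eq_iff fraction_add fraction_mult fraction_closed f o nat_pow_mult[symmetric] Groups.add_ac
  show ?thesis
  proof (rule cringI)
    show "abelian_group ?L"
    proof (rule abelian_groupI, goal_cases)
      case (1 x y) then show ?case using f by (auto elim!: fraction_cases simp: s)
    next
      case 2 show ?case by (simp add: s)
    next
      case (3 x y z) then show ?case using f
        by (auto elim!: fraction_cases simp: s m_ac l_distr r_distr a_ac)
    next
      case (4 x y) then show ?case using f
        by (auto elim!: fraction_cases simp: s m_ac l_distr r_distr a_ac)
    next
      case (5 x) then show ?case using f
        by (auto elim!: fraction_cases simp: s m_ac l_distr r_distr a_ac)
    next
      case (6 x)
      then obtain r m where x: "r \<in> carrier R" "x = fraction R f r m" by (rule fraction_cases)
      show ?case
        by (rule bexI[of _ "fraction R f (\<ominus> r) m"])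
          (use x f in \<open>auto simp: s l_distr[symmetric] l_neg\<close>)
    qed
    show "comm_monoid ?L"
    proof (rule comm_monoidI, goal_cases)
      case (1 x y) then show ?case using f by (auto elim!: fraction_cases simp: s)
    qed (use f in \<open>auto elim!: fraction_cases simp: s m_ac\<close>)
    fix x y z assume "x \<in> carrier ?L" "y \<in> carrier ?L" "z \<in> carrier ?L"
    then obtain a i b j c k where
      "a \<in> carrier R" "x = fraction R f a i" "b \<in> carrier R" "y = fraction R f b j"
      "c \<in> carrier R" "z = fraction R f c k"
      by (metis fraction_cases)
    then show "(x \<oplus>\<^bsub>?L\<^esub> y) \<otimes>\<^bsub>?L\<^esub> z = x \<otimes>\<^bsub>?L\<^esub> z \<oplus>\<^bsub>?L\<^esub> y \<otimes>\<^bsub>?L\<^esub> z"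
      using f by (simp add: fraction_mult fraction_add fraction_eq_iff nat_pow_mult[symmetric] m_ac l_distr r_distr)
  qed
qed

lemma diff_ops_upto_linear:
  assumes "\<delta> \<in> diff_ops_upto R K n" "K \<subseteq> carrier R"
  shows "\<delta> \<in> linear_endos R K"
  using assms by (cases n) (auto simp: linear_endos_def)

lemma diff_ops_upto_closed:
  assumes "\<delta> \<in> diff_ops_upto R K n" "x \<in> carrier R"
  shows "\<delta> x \<in> carrier R"
  using assms by (cases n) (auto simp: linear_endos_def)

lemma diff_ops_upto_Suc:
  assumes K: "K \<subseteq> carrier R"
  shows "diff_ops_upto R K n \<subseteq> diff_ops_upto R K (Suc n)"
proof (induction n)
  case 0
  show ?case
  proof
    fix \<delta> assume d: "\<delta> \<in> diff_ops_upto R K 0"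
    have "commutator R \<delta> r = (\<lambda>x \<in> carrier R. \<zero>)" if "r \<in> carrier R" for r
      using that d by (auto simp: commutator_def linear_endos_def a_minus_def r_neg PiE_def Pi_def)
    then show "\<delta> \<in> diff_ops_upto R K (Suc 0)"
      using diff_ops_upto_linear[OF d K] by (auto simp: linear_endos_def)
  qed
next
  case (Suc n)
  then show ?case by auto
qed

lemma diff_ops_upto_mono:
  assumes K: "K \<subseteq> carrier R" and "m \<le> n"
  shows "diff_ops_upto R K m \<subseteq> diff_ops_upto R K n"
  using lift_Suc_mono_le[of "diff_ops_upto R K", OF diff_ops_upto_Suc[OF K]] assms(2) by blast

lemma diff_ops_upto_eqI:
  assumes B: "B \<subseteq> carrier R"
    and G: "\<And>x. x \<in> carrier R \<Longrightarrow> \<exists>g \<in> Units R. g \<otimes> x \<in> B \<and> (\<forall>b \<in> B. g \<otimes> b \<in> B)"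
  shows "\<delta> \<in> diff_ops_upto R K n \<Longrightarrow> \<epsilon> \<in> diff_ops_upto R K n \<Longrightarrow> (\<And>b. b \<in> B \<Longrightarrow> \<delta> b = \<epsilon> b)
    \<Longrightarrow> \<delta> = \<epsilon>"
proof (induction n arbitrary: \<delta> \<epsilon>)
  case 0
  show ?case
  proof (rule PiE_ext)
    show "\<delta> \<in> carrier R \<rightarrow>\<^sub>E carrier R" "\<epsilon> \<in> carrier R \<rightarrow>\<^sub>E carrier R"
      using 0(1,2) by (simp_all add: linear_endos_def)
    fix x assume x: "x \<in> carrier R"
    obtain g where g: "g \<in> Units R" "g \<otimes> x \<in> B" using G[OF x] by blast
    have cl: "\<delta> x \<in> carrier R" "\<epsilon> x \<in> carrier R"
      using 0(1,2) x diff_ops_upto_closed by blast+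
    have "\<delta> (g \<otimes> x) = g \<otimes> \<delta> x" "\<epsilon> (g \<otimes> x) = g \<otimes> \<epsilon> x"
      using 0(1,2) Units_closed[OF g(1)] x by (simp_all add: linear_endos_def)
    then have "g \<otimes> \<delta> x = g \<otimes> \<epsilon> x" using 0(3)[OF g(2)] by simp
    then show "\<delta> x = \<epsilon> x" using Units_l_cancel[OF g(1) cl] by blast
  qed
next
  case (Suc n)
  show ?case
  proof (rule PiE_ext)
    show "\<delta> \<in> carrier R \<rightarrow>\<^sub>E carrier R" "\<epsilon> \<in> carrier R \<rightarrow>\<^sub>E carrier R"
      using Suc.prems(1,2) by (simp_all add: linear_endos_def)
    fix x assume x: "x \<in> carrier R"
    obtain g where g: "g \<in> Units R" "g \<otimes> x \<in> B" "\<forall>b \<in> B. g \<otimes> b \<in> B" using G[OF x] by blast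
    have c: "commutator R \<delta> g = commutator R \<epsilon> g"
    proof (rule Suc.IH)
      show "commutator R \<delta> g \<in> diff_ops_upto R K n" "commutator R \<epsilon> g \<in> diff_ops_upto R K n"
        using Suc.prems(1,2) Units_closed[OF g(1)] by simp_all
      fix b assume b: "b \<in> B"
      have "\<delta> b = \<epsilon> b" "\<delta> (g \<otimes> b) = \<epsilon> (g \<otimes> b)"
        using Suc.prems(3) b g(3) by blast+
      then show "commutator R \<delta> g b = commutator R \<epsilon> g b"
        by (simp only: commutator_def restrict_def)
    qed
    have cl: "\<delta> x \<in> carrier R" "\<epsilon> x \<in> carrier R" "\<delta> (g \<otimes> x) \<in> carrier R" "g \<in> carrier R"
      using diff_ops_upto_closed[OF Suc.prems(1)] diff_ops_upto_closed[OF Suc.prems(2)] x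
        Units_closed[OF g(1)] by simp_all
    have "\<delta> (g \<otimes> x) \<ominus> g \<otimes> \<delta> x = \<delta> (g \<otimes> x) \<ominus> g \<otimes> \<epsilon> x"
      using fun_cong[OF c, of x] x Suc.prems(3)[OF g(2)] by (simp add: commutator_def)
    then have "\<ominus> (g \<otimes> \<delta> x) = \<ominus> (g \<otimes> \<epsilon> x)"
      using cl by (simp add: a_minus_def)
    then have "\<ominus> (\<ominus> (g \<otimes> \<delta> x)) = \<ominus> (\<ominus> (g \<otimes> \<epsilon> x))" by (rule arg_cong)
    then have "g \<otimes> \<delta> x = g \<otimes> \<epsilon> x" using cl by (simp only: minus_minus m_closed)
    then show "\<delta> x = \<epsilon> x" using Units_l_cancel[OF g(1) cl(1,2)] by blast
  qed
qed

lemma loc_extension_unique: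
  assumes f: "f \<in> carrier R" and A: "A \<subseteq> carrier R"
    and "loc_extension R A f \<delta> \<delta>1" "loc_extension R A f \<delta> \<delta>2"
  shows "\<delta>1 = \<delta>2"
proof -
  let ?L = "localization R f" and ?K = "to_loc R f ` A" and ?B = "to_loc R f ` carrier R"
  interpret L: cring ?L using cring_localization[OF f] .
  have K: "?K \<subseteq> carrier ?L" using A fraction_closed by blast
  obtain m n where "\<delta>1 \<in> diff_ops_upto ?L ?K m" "\<delta>2 \<in> diff_ops_upto ?L ?K n"
    using assms by (auto simp: loc_extension_def diff_ops_def)
  then have d: "\<delta>1 \<in> diff_ops_upto ?L ?K (max m n)" "\<delta>2 \<in> diff_ops_upto ?L ?K (max m n)"
    using L.diff_ops_upto_mono[OF K] by (meson max.cobounded1 max.cobounded2 subsetD)+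
  show ?thesis
  proof (rule L.diff_ops_upto_eqI[OF _ _ d])
    show "?B \<subseteq> carrier ?L" using fraction_closed by blast
    show "\<delta>1 b = \<delta>2 b" if "b \<in> ?B" for b using that assms by (auto simp: loc_extension_def)
    fix x assume "x \<in> carrier ?L"
    then obtain r m where x: "r \<in> carrier R" "x = fraction R f r m" by (rule fraction_cases)
    let ?g = "to_loc R f (f [^] m)"
    have "?g \<otimes>\<^bsub>?L\<^esub> fraction R f \<one> m = \<one>\<^bsub>?L\<^esub>"
    proof -
      have "\<one>\<^bsub>?L\<^esub> = to_loc R f \<one>" by (simp add: localization_def)
      then show ?thesis using f by (simp add: fraction_mult fraction_eq_iff)
    qed
    then have "?g \<in> Units ?L"
      using f fraction_closed[of "f [^] m" f 0] fraction_closed[of \<one> f m]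
      by (auto simp: Units_def L.m_comm intro!: bexI[of _ "fraction R f \<one> m"])
    moreover have "?g \<otimes>\<^bsub>?L\<^esub> x = to_loc R f r"
      using f x by (auto simp: fraction_mult fraction_eq_iff m_ac)
    moreover have "\<forall>b \<in> ?B. ?g \<otimes>\<^bsub>?L\<^esub> b \<in> ?B" using f by (auto simp: fraction_mult)
    ultimately show "\<exists>g \<in> Units ?L. g \<otimes>\<^bsub>?L\<^esub> x \<in> ?B \<and> (\<forall>b \<in> ?B. g \<otimes>\<^bsub>?L\<^esub> b \<in> ?B)"
      using x by auto
  qed
qed

end


section \<open>Bernstein--Sato polynomials\<close>

abbreviation poly_ring_over :: "('a, 'm) ring_scheme \<Rightarrow> 'a set \<Rightarrow> ('a, nat \<Rightarrow> 'a) up_ring" where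
  "poly_ring_over R A \<equiv> UP (R\<lparr>carrier := A\<rparr>)"

definition eval_int :: "('a, 'm) ring_scheme \<Rightarrow> 'a set \<Rightarrow> (nat \<Rightarrow> 'a) \<Rightarrow> int \<Rightarrow> 'a" where
  "eval_int R A b t = eval (R\<lparr>carrier := A\<rparr>) R id (add_pow R t \<one>\<^bsub>R\<^esub>) b"

text \<open>
  The functional equation is an identity in \<open>R\<close> for \<open>t \<ge> 0\<close> and an identity in the
  localization at \<open>f\<close> for \<open>t < 0\<close>; the two cases have to be kept apart because \<open>R\<close> need not
  embed in the localization. The operator \<open>\<delta>'\<close> is the unique extension of \<open>\<delta>\<close>
  (\<open>loc_extension_unique\<close>).
\<close>

definition functional_equation ::
    "('a, 'm) ring_scheme \<Rightarrow> 'a set \<Rightarrow> 'a \<Rightarrow> ('a \<Rightarrow> 'a) \<Rightarrow> (nat \<Rightarrow> 'a) \<Rightarrow> bool" where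
  "functional_equation R A f \<delta> b \<longleftrightarrow>
    (\<forall>t::nat. \<delta> (f [^]\<^bsub>R\<^esub> (t + 1)) = eval_int R A b (int t) \<otimes>\<^bsub>R\<^esub> f [^]\<^bsub>R\<^esub> t) \<and>
    (\<exists>\<delta>'. loc_extension R A f \<delta> \<delta>' \<and>
      (\<forall>t::int. t < 0 \<longrightarrow>
        \<delta>' (to_loc R f f [^]\<^bsub>localization R f\<^esub> (t + 1)) =
          to_loc R f (eval_int R A b t) \<otimes>\<^bsub>localization R f\<^esub>
            to_loc R f f [^]\<^bsub>localization R f\<^esub> t))"

definition monic_poly :: "('a, 'm) ring_scheme \<Rightarrow> 'a set \<Rightarrow> (nat \<Rightarrow> 'a) \<Rightarrow> bool" where
  "monic_poly R A b \<longleftrightarrow>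
    b \<in> carrier (poly_ring_over R A) \<and>
    coeff (poly_ring_over R A) b (deg (R\<lparr>carrier := A\<rparr>) b) = \<one>\<^bsub>R\<^esub>"

definition is_bernstein_sato :: "('a, 'm) ring_scheme \<Rightarrow> 'a set \<Rightarrow> 'a \<Rightarrow> (nat \<Rightarrow> 'a) \<Rightarrow> bool" where
  "is_bernstein_sato R A f b \<longleftrightarrow>
    monic_poly R A b \<and>
    (\<exists>\<delta> \<in> diff_ops R A. functional_equation R A f \<delta> b) \<and>
    (\<forall>\<delta> \<in> diff_ops R A. \<forall>c \<in> carrier (poly_ring_over R A).
      functional_equation R A f \<delta> c \<longrightarrow> b divides\<^bsub>poly_ring_over R A\<^esub> c)"

definition has_bernstein_sato :: "('a, 'm) ring_scheme \<Rightarrow> 'a set \<Rightarrow> 'a \<Rightarrow> bool" where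
  "has_bernstein_sato R A f \<longleftrightarrow> (\<exists>b. is_bernstein_sato R A f b)"

lemma (in UP_cring) monic_divides_antisym:
  assumes p: "p \<in> carrier P" "up_ring.coeff P p (deg R p) = \<one>"
    and q: "q \<in> carrier P" "up_ring.coeff P q (deg R q) = \<one>"
    and "p divides\<^bsub>P\<^esub> q" "q divides\<^bsub>P\<^esub> p"
  shows "p = q"
proof -
  have lc: "up_ring.coeff P (u \<otimes>\<^bsub>P\<^esub> c) (deg R u + deg R c) = up_ring.coeff P c (deg R c)"
    if u: "u \<in> carrier P" "up_ring.coeff P u (deg R u) = \<one>" and c: "c \<in> carrier P" for u c
  proof -
    have "up_ring.coeff P (u \<otimes>\<^bsub>P\<^esub> c) (deg R u + deg R c) =
        (\<Oplus>i \<in> {..deg R u + deg R c}. up_ring.coeff P u i \<otimes> up_ring.coeff P c (deg R u + deg R c - i))"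
      using u c by simp
    also have "\<dots> = (\<Oplus>i \<in> {..deg R u + deg R c}. if deg R u = i then up_ring.coeff P c (deg R c) else \<zero>)"
    proof (rule R.finsum_cong')
      fix i assume "i \<in> {..deg R u + deg R c}"
      show "up_ring.coeff P u i \<otimes> up_ring.coeff P c (deg R u + deg R c - i) =
          (if deg R u = i then up_ring.coeff P c (deg R c) else \<zero>)"
      proof (cases i "deg R u" rule: linorder_cases)
        case less
        then have "up_ring.coeff P c (deg R u + deg R c - i) = \<zero>" using c by (intro deg_aboveD) auto
        then show ?thesis using less u c by simp
      next
        case equal then show ?thesis using u c by simp
      next
        case greater
        then have "up_ring.coeff P u i = \<zero>" using u by (intro deg_aboveD) auto
        then show ?thesis using greater u c by simp
      qed
    qed (use u c in auto)
    also have "\<dots> = up_ring.coeff P c (deg R c)"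
      using c by (subst R.finsum_singleton) auto
    finally show ?thesis .
  qed
  obtain c where c: "c \<in> carrier P" "q = p \<otimes>\<^bsub>P\<^esub> c" using assms by (auto simp: factor_def)
  obtain d where d: "d \<in> carrier P" "p = q \<otimes>\<^bsub>P\<^esub> d" using assms by (auto simp: factor_def)
  have le: "deg R u + deg R c \<le> deg R (u \<otimes>\<^bsub>P\<^esub> c)"
    if u: "u \<in> carrier P" "up_ring.coeff P u (deg R u) = \<one>" and c: "c \<in> carrier P" "c \<noteq> \<zero>\<^bsub>P\<^esub>" for u c
    using lc[OF u c(1)] lcoeff_nonzero[OF c(2,1)] u c by (intro deg_belowI) (auto simp del: coeff_mult)
  show ?thesis
  proof (cases "c = \<zero>\<^bsub>P\<^esub>")
    case True
    then have "q = \<zero>\<^bsub>P\<^esub>" "p = \<zero>\<^bsub>P\<^esub>" using c d p q by auto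
    then show ?thesis by simp
  next
    case False
    have dz: "d \<noteq> \<zero>\<^bsub>P\<^esub>"
    proof
      assume "d = \<zero>\<^bsub>P\<^esub>"
      then have "p = \<zero>\<^bsub>P\<^esub>" using d q by simp
      then have "q = \<zero>\<^bsub>P\<^esub>" using c by simp
      then have "\<one> = \<zero>" using q by simp
      then have "up_ring.coeff P c (deg R c) = \<zero>"
        by (metis R.r_null R.r_one c(1) lcoeff_closed)
      then show False using lcoeff_nonzero[OF False c(1)] by simp
    qed
    have "deg R p + deg R c \<le> deg R q" "deg R q + deg R d \<le> deg R p"
      using le[OF p c(1) False] le[OF q d(1) dz] unfolding c(2)[symmetric] d(2)[symmetric] .
    then have deg: "deg R c = 0" "deg R p = deg R q" by auto
    then have "up_ring.coeff P c 0 = \<one>" using lc[OF p c(1)] q(2) by (simp only: c(2)[symmetric] add_0_right)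
    then have "c = \<one>\<^bsub>P\<^esub>" using deg_zero_impl_monom[OF c(1) deg(1)] by simp
    then show ?thesis using c(2) p(1) by simp
  qed
qed

lemma is_bernstein_sato_unique:
  assumes "cring R" "subring A R" "is_bernstein_sato R A f b" "is_bernstein_sato R A f c"
  shows "b = c"
proof -
  have "subcring A R" using assms cring.subcringI' by blast
  then have "cring (R\<lparr>carrier := A\<rparr>)"
    using assms(1) using ring.subcring_iff[OF cring.axioms(1) subcringE(1)] by blast
  then interpret UP_cring "R\<lparr>carrier := A\<rparr>" "UP (R\<lparr>carrier := A\<rparr>)"
    by (simp_all add: UP_cring_def)
  show ?thesis
    by (rule monic_divides_antisym)
      (use assms(3,4) in \<open>auto simp: is_bernstein_sato_def monic_poly_def\<close>)
qed

definition bernstein_sato_poly :: "('a, 'm) ring_scheme \<Rightarrow> 'a set \<Rightarrow> 'a \<Rightarrow> (nat \<Rightarrow> 'a)" where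
  "bernstein_sato_poly R A f = (THE b. is_bernstein_sato R A f b)"

end

theory Submission
  imports Defs
begin

text \<open>
  Let \<open>\<beta>\<close> be an \<open>R\<close>-linear projection of \<open>S\<close> onto \<open>R\<close>. If \<open>\<delta>\<close> is an operator on \<open>S\<close> with
  \<open>\<delta> f\<^bsup>t+1\<^esup> = b(t) f\<^sup>t\<close>, then \<open>\<beta> \<circ> \<delta>\<close> restricted to \<open>R\<close> is an operator on \<open>R\<close> with the same
  property, because \<open>b(t) f\<^sup>t\<close> is fixed by \<open>\<beta>\<close>; negative \<open>t\<close> are treated in the same way with the
  localized projection. Conversely, a functional equation over \<open>R\<close> holds over \<open>S\<close> for any operator
  on \<open>S\<close> extending the given one: differential operators extend uniquely to localizations, so the
  extension to \<open>S\<^sub>f\<close> restricts on \<open>R\<^sub>f\<close> to the extension of the original operator. Hence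
  the same polynomials occur in functional equations over \<open>R\<close> and over \<open>S\<close>.
\<close>

section \<open>Operations on differential operators\<close>

lemma linear_endosD:
  assumes "\<phi> \<in> linear_endos R K"
  shows "\<phi> \<in> carrier R \<rightarrow>\<^sub>E carrier R"
    and "x \<in> carrier R \<Longrightarrow> \<phi> x \<in> carrier R"
    and "x \<in> carrier R \<Longrightarrow> y \<in> carrier R \<Longrightarrow> \<phi> (x \<oplus>\<^bsub>R\<^esub> y) = \<phi> x \<oplus>\<^bsub>R\<^esub> \<phi> y"
    and "a \<in> K \<Longrightarrow> x \<in> carrier R \<Longrightarrow> \<phi> (a \<otimes>\<^bsub>R\<^esub> x) = a \<otimes>\<^bsub>R\<^esub> \<phi> x"
  using assms by (auto simp: linear_endos_def)

lemma commutator_apply: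
  "x \<in> carrier R \<Longrightarrow> commutator R \<delta> r x = \<delta> (r \<otimes>\<^bsub>R\<^esub> x) \<ominus>\<^bsub>R\<^esub> r \<otimes>\<^bsub>R\<^esub> \<delta> x"
  by (simp add: commutator_def)

lemma (in cring) a_minus_eq_iff:
  assumes "x \<in> carrier R" "y \<in> carrier R" "z \<in> carrier R"
  shows "x \<ominus> y = z \<longleftrightarrow> x = y \<oplus> z"
  using assms by (metis a_minus_def add.inv_closed add.m_comm add.inv_solve_right)

lemma (in cring) minus_left_cancel:
  assumes "x \<in> carrier R" "y \<in> carrier R" "z \<in> carrier R"
  shows "x \<ominus> y = x \<ominus> z \<longleftrightarrow> y = z"
  using assms by (metis a_minus_def a_inv_closed add.l_cancel minus_minus)

text \<open>Obtained from x = y + (x - y). It is stated for merely additive maps because it is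
  applied to projections, which in general are not ring homomorphisms.\<close>

lemma additive_minus:
  assumes "cring P" "cring Q"
    and h: "h \<in> carrier P \<rightarrow> carrier Q"
    and add: "\<And>x y. x \<in> carrier P \<Longrightarrow> y \<in> carrier P \<Longrightarrow> h (x \<oplus>\<^bsub>P\<^esub> y) = h x \<oplus>\<^bsub>Q\<^esub> h y"
    and x: "x \<in> carrier P" and y: "y \<in> carrier P"
  shows "h (x \<ominus>\<^bsub>P\<^esub> y) = h x \<ominus>\<^bsub>Q\<^esub> h y"
proof -
  interpret P: cring P by fact
  interpret Q: cring Q by fact
  have "x = y \<oplus>\<^bsub>P\<^esub> (x \<ominus>\<^bsub>P\<^esub> y)" using P.a_minus_eq_iff[of x y] x y by blast
  then have "h x = h y \<oplus>\<^bsub>Q\<^esub> h (x \<ominus>\<^bsub>P\<^esub> y)" using add[of y "x \<ominus>\<^bsub>P\<^esub> y"] x y by simp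
  then show ?thesis using Q.a_minus_eq_iff[of "h x" "h y" "h (x \<ominus>\<^bsub>P\<^esub> y)"] x y h by (simp add: Pi_iff)
qed

text \<open>Since \<open>\<alpha>\<close> and \<open>\<beta>\<close> are semilinear along
  \<open>\<sigma>\<close>, the commutator of the composite with r is the same composite formed with
  the commutator of \<open>\<delta>\<close> and \<open>\<sigma> r\<close>; induction on the order
  then applies. The instances are multiplication maps, the projection onto a direct summand, and its
  localization.\<close>

lemma diff_ops_upto_compose:
  assumes P: "cring P" and Q: "cring Q"
    and \<sigma>: "\<sigma> \<in> carrier P \<rightarrow> carrier Q" "\<And>k. k \<in> K \<Longrightarrow> \<sigma> k \<in> L"
    and K: "K \<subseteq> carrier P"
    and \<alpha>: "\<alpha> \<in> carrier P \<rightarrow> carrier Q"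
      "\<And>x y. x \<in> carrier P \<Longrightarrow> y \<in> carrier P \<Longrightarrow> \<alpha> (x \<oplus>\<^bsub>P\<^esub> y) = \<alpha> x \<oplus>\<^bsub>Q\<^esub> \<alpha> y"
      "\<And>r x. r \<in> carrier P \<Longrightarrow> x \<in> carrier P \<Longrightarrow> \<alpha> (r \<otimes>\<^bsub>P\<^esub> x) = \<sigma> r \<otimes>\<^bsub>Q\<^esub> \<alpha> x"
    and \<beta>: "\<beta> \<in> carrier Q \<rightarrow> carrier P"
      "\<And>x y. x \<in> carrier Q \<Longrightarrow> y \<in> carrier Q \<Longrightarrow> \<beta> (x \<oplus>\<^bsub>Q\<^esub> y) = \<beta> x \<oplus>\<^bsub>P\<^esub> \<beta> y"
      "\<And>r x. r \<in> carrier P \<Longrightarrow> x \<in> carrier Q \<Longrightarrow> \<beta> (\<sigma> r \<otimes>\<^bsub>Q\<^esub> x) = r \<otimes>\<^bsub>P\<^esub> \<beta> x"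
    and \<delta>: "\<delta> \<in> diff_ops_upto Q L n"
  shows "(\<lambda>x \<in> carrier P. \<beta> (\<delta> (\<alpha> x))) \<in> diff_ops_upto P K n"
proof -
  interpret P: cring P by fact
  interpret Q: cring Q by fact
  \<comment> \<open>Arbitrary scalar sets, because order zero asks for linearity over the whole
    carriers and positive order for linearity over \<open>K\<close> and \<open>L\<close>.\<close>
  have lin: "(\<lambda>x \<in> carrier P. \<beta> (\<delta> (\<alpha> x))) \<in> linear_endos P K'"
    if "\<delta> \<in> linear_endos Q L'" "\<And>k. k \<in> K' \<Longrightarrow> \<sigma> k \<in> L'" "K' \<subseteq> carrier P" for \<delta> K' L'
    using that(2,3) \<sigma>(1) \<alpha> \<beta> linear_endosD[OF that(1)]
    by (auto simp: linear_endos_def Pi_iff subset_iff)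
  show ?thesis using \<delta>
  proof (induction n arbitrary: \<delta>)
    case 0
    then have "\<delta> \<in> linear_endos Q (carrier Q)" by simp
    then show ?case unfolding diff_ops_upto.simps by (rule lin) (use \<sigma>(1) in auto)
  next
    case (Suc n)
    then have d: "\<delta> \<in> linear_endos Q L" by simp
    note dc = linear_endosD(2)[OF d]
    have "commutator P (\<lambda>x \<in> carrier P. \<beta> (\<delta> (\<alpha> x))) r =
        (\<lambda>x \<in> carrier P. \<beta> (commutator Q \<delta> (\<sigma> r) (\<alpha> x)))" if r: "r \<in> carrier P" for r
      unfolding commutator_def[of P]
    proof (rule restrict_ext)
      fix x assume x: "x \<in> carrier P"
      have c: "\<sigma> r \<in> carrier Q" "\<alpha> x \<in> carrier Q" using \<sigma>(1) \<alpha>(1) r x by auto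
      have "\<beta> (\<delta> (\<sigma> r \<otimes>\<^bsub>Q\<^esub> \<alpha> x) \<ominus>\<^bsub>Q\<^esub> \<sigma> r \<otimes>\<^bsub>Q\<^esub> \<delta> (\<alpha> x)) =
          \<beta> (\<delta> (\<sigma> r \<otimes>\<^bsub>Q\<^esub> \<alpha> x)) \<ominus>\<^bsub>P\<^esub> \<beta> (\<sigma> r \<otimes>\<^bsub>Q\<^esub> \<delta> (\<alpha> x))"
        using additive_minus[OF Q P \<beta>(1,2)] c dc by simp
      then show "(\<lambda>x \<in> carrier P. \<beta> (\<delta> (\<alpha> x))) (r \<otimes>\<^bsub>P\<^esub> x) \<ominus>\<^bsub>P\<^esub>
            r \<otimes>\<^bsub>P\<^esub> (\<lambda>x \<in> carrier P. \<beta> (\<delta> (\<alpha> x))) x = \<beta> (commutator Q \<delta> (\<sigma> r) (\<alpha> x))"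
        using x r c dc by (simp add: commutator_apply \<alpha>(3) \<beta>(3))
    qed
    then show ?case using Suc lin[OF d \<sigma>(2) K] \<sigma>(1) by (auto simp del: restrict_apply)
  qed
qed

context cring begin

text \<open>With \<open>\<sigma>\<close> the identity, multiplication by \<open>a\<close> serves as
  the outer map here and as the inner map in the next lemma. Together with differences, these
  operations later assemble commutators with fractions.\<close>

lemma diff_ops_upto_lmult:
  assumes "K \<subseteq> carrier R" "a \<in> carrier R" "\<delta> \<in> diff_ops_upto R K n"
  shows "(\<lambda>x \<in> carrier R. a \<otimes> \<delta> x) \<in> diff_ops_upto R K n"
  by (rule diff_ops_upto_compose[where \<sigma> = "\<lambda>x. x" and \<alpha> = "\<lambda>x. x" and \<beta> = "\<lambda>x. a \<otimes> x",
        OF cring_axioms cring_axioms _ _ _ _ _ _ _ _ _ assms(3)])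
    (use assms in \<open>auto simp: r_distr m_lcomm\<close>)

lemma diff_ops_upto_rmult:
  assumes "K \<subseteq> carrier R" "a \<in> carrier R" "\<delta> \<in> diff_ops_upto R K n"
  shows "(\<lambda>x \<in> carrier R. \<delta> (a \<otimes> x)) \<in> diff_ops_upto R K n"
  by (rule diff_ops_upto_compose[where \<sigma> = "\<lambda>x. x" and \<alpha> = "\<lambda>x. a \<otimes> x" and \<beta> = "\<lambda>x. x",
        OF cring_axioms cring_axioms _ _ _ _ _ _ _ _ _ assms(3)])
    (use assms in \<open>auto simp: r_distr m_lcomm\<close>)

text \<open>The commutator with a fixed r is additive in the operator, so differences pass through
  the induction on the order.\<close>

lemma diff_ops_upto_minus:
  assumes K: "K \<subseteq> carrier R"
  shows "\<delta> \<in> diff_ops_upto R K n \<Longrightarrow> \<epsilon> \<in> diff_ops_upto R K n \<Longrightarrow>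
    (\<lambda>x \<in> carrier R. \<delta> x \<ominus> \<epsilon> x) \<in> diff_ops_upto R K n"
proof (induction n arbitrary: \<delta> \<epsilon>)
  have lin: "(\<lambda>x \<in> carrier R. \<delta> x \<ominus> \<epsilon> x) \<in> linear_endos R K'"
    if "\<delta> \<in> linear_endos R K'" "\<epsilon> \<in> linear_endos R K'" "K' \<subseteq> carrier R" for \<delta> \<epsilon> K'
  proof -
    note d = linear_endosD(2-4)[OF that(1)] and e = linear_endosD(2-4)[OF that(2)]
    have add: "\<delta> (x \<oplus> y) \<ominus> \<epsilon> (x \<oplus> y) = \<delta> x \<ominus> \<epsilon> x \<oplus> (\<delta> y \<ominus> \<epsilon> y)"
      if xy: "x \<in> carrier R" "y \<in> carrier R" for x y
    proof -
      have "\<delta> x \<in> carrier R" "\<delta> y \<in> carrier R" "\<epsilon> x \<in> carrier R" "\<epsilon> y \<in> carrier R"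
        using d e xy by auto
      then have "\<delta> x \<oplus> \<delta> y \<ominus> (\<epsilon> x \<oplus> \<epsilon> y) = \<delta> x \<ominus> \<epsilon> x \<oplus> (\<delta> y \<ominus> \<epsilon> y)" by algebra
      then show ?thesis using xy by (simp add: d e)
    qed
    have smult: "\<delta> (a \<otimes> x) \<ominus> \<epsilon> (a \<otimes> x) = a \<otimes> (\<delta> x \<ominus> \<epsilon> x)"
      if ax: "a \<in> K'" "x \<in> carrier R" for a x
    proof -
      have "\<delta> x \<in> carrier R" "\<epsilon> x \<in> carrier R" "a \<in> carrier R" using d e that ax \<open>K' \<subseteq> carrier R\<close> by auto
      then have "a \<otimes> \<delta> x \<ominus> a \<otimes> \<epsilon> x = a \<otimes> (\<delta> x \<ominus> \<epsilon> x)" by algebra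
      then show ?thesis using ax by (simp add: d e)
    qed
    show ?thesis unfolding linear_endos_def
      using add smult d(1) e(1) \<open>K' \<subseteq> carrier R\<close> by auto
  qed
  {
    case 0
    then have "\<delta> \<in> linear_endos R (carrier R)" "\<epsilon> \<in> linear_endos R (carrier R)" by simp_all
    then show ?case unfolding diff_ops_upto.simps by (rule lin) simp
  next
    case (Suc n)
    then have de: "\<delta> \<in> linear_endos R K" "\<epsilon> \<in> linear_endos R K" by auto
    have "commutator R (\<lambda>x \<in> carrier R. \<delta> x \<ominus> \<epsilon> x) r =
        (\<lambda>x \<in> carrier R. commutator R \<delta> r x \<ominus> commutator R \<epsilon> r x)" if r: "r \<in> carrier R" for r
      unfolding commutator_def[of R "\<lambda>x \<in> carrier R. \<delta> x \<ominus> \<epsilon> x"]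
    proof (rule restrict_ext)
      fix x assume x: "x \<in> carrier R"
      have c: "\<delta> x \<in> carrier R" "\<epsilon> x \<in> carrier R" "\<delta> (r \<otimes> x) \<in> carrier R" "\<epsilon> (r \<otimes> x) \<in> carrier R"
        using linear_endosD(2)[OF de(1)] linear_endosD(2)[OF de(2)] r x by auto
      then have "\<delta> (r \<otimes> x) \<ominus> \<epsilon> (r \<otimes> x) \<ominus> r \<otimes> (\<delta> x \<ominus> \<epsilon> x) =
          \<delta> (r \<otimes> x) \<ominus> r \<otimes> \<delta> x \<ominus> (\<epsilon> (r \<otimes> x) \<ominus> r \<otimes> \<epsilon> x)" using r by algebra
      then show "(\<lambda>x \<in> carrier R. \<delta> x \<ominus> \<epsilon> x) (r \<otimes> x) \<ominus> r \<otimes> (\<lambda>x \<in> carrier R. \<delta> x \<ominus> \<epsilon> x) x =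
          commutator R \<delta> r x \<ominus> commutator R \<epsilon> r x"
        using r x by (simp add: commutator_apply)
    qed
    then show ?case using Suc lin[OF de K] by (auto simp del: restrict_apply)
  }
qed

end

section \<open>Extension of differential operators to rings of fractions\<close>

lemma (in ring_hom_cring) hom_Units:
  assumes "x \<in> Units R"
  shows "h x \<in> Units S"
proof -
  have "h x \<otimes>\<^bsub>S\<^esub> h (inv x) = \<one>\<^bsub>S\<^esub>"
    using assms R.Units_closed R.Units_inv_closed R.Units_r_inv hom_mult hom_one by metis
  moreover have "h x \<in> carrier S" "h (inv x) \<in> carrier S" using assms by auto
  ultimately show ?thesis using S.m_comm[of "h (inv x)" "h x"] by (auto simp: Units_def)
qed

text \<open>The two assumptions say that \<open>S\<close> is the localization of \<open>R\<close> at
  the elements that \<open>h\<close> makes invertible: denominators can be cleared, and whatever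
  becomes zero is killed by such an element. Uniqueness and extension of operators are proved from
  this alone, without pairs or powers of \<open>f\<close>.\<close>

locale ring_of_fractions = ring_hom_cring +
  assumes frac: "x \<in> carrier S \<Longrightarrow>
      \<exists>g \<in> carrier R. \<exists>r \<in> carrier R. h g \<in> Units S \<and> h g \<otimes>\<^bsub>S\<^esub> x = h r"
    and frac_zero: "u \<in> carrier R \<Longrightarrow> h u = \<zero>\<^bsub>S\<^esub> \<Longrightarrow>
      \<exists>g \<in> carrier R. h g \<in> Units S \<and> g \<otimes> u = \<zero>"
begin

text \<open>For \<open>j\<close> the identity this says that extensions are unique; the general form compares an
  operator on \<open>R\<^sub>f\<close> with one on \<open>S\<^sub>f\<close>.\<close>

lemma diff_ops_upto_intertwine:
  assumes j: "ring_hom_cring S T j"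
  shows "\<delta> \<in> diff_ops_upto S K n \<Longrightarrow> \<epsilon> \<in> diff_ops_upto T L n \<Longrightarrow>
    (\<And>r. r \<in> carrier R \<Longrightarrow> \<epsilon> (j (h r)) = j (\<delta> (h r))) \<Longrightarrow> x \<in> carrier S \<Longrightarrow> \<epsilon> (j x) = j (\<delta> x)"
proof (induction n arbitrary: \<delta> \<epsilon> x)
  case 0
  interpret j: ring_hom_cring S T j by fact
  from 0 have d: "\<delta> \<in> linear_endos S (carrier S)" and e: "\<epsilon> \<in> linear_endos T (carrier T)" by auto
  have x: "x \<in> carrier S" by fact
  note dc = linear_endosD(2)[OF d] and ec = linear_endosD(2)[OF e]
  obtain g r where g: "g \<in> carrier R" "r \<in> carrier R" "h g \<in> Units S" "h g \<otimes>\<^bsub>S\<^esub> x = h r"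
    using frac x by blast
  have u: "j (h g) \<in> Units T" using j.hom_Units g(3) .
  \<comment> \<open>An operator of order zero is linear over the whole ring, so multiplying by a
    unit that clears the denominator reduces the claim to the image of \<open>R\<close>.\<close>
  have "j (h g) \<otimes>\<^bsub>T\<^esub> \<epsilon> (j x) = \<epsilon> (j (h g) \<otimes>\<^bsub>T\<^esub> j x)"
    using linear_endosD(4)[OF e] g x by simp
  also have "j (h g) \<otimes>\<^bsub>T\<^esub> j x = j (h r)" using g(1) x by (simp flip: j.hom_mult g(4))
  also have "\<epsilon> (j (h r)) = j (\<delta> (h r))" using 0(3)[OF g(2)] .
  also have "\<dots> = j (h g) \<otimes>\<^bsub>T\<^esub> j (\<delta> x)"
    using linear_endosD(4)[OF d] g x dc by (simp flip: g(4))
  finally show ?case using j.S.Units_l_cancel[OF u] x dc ec by simp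
next
  case (Suc n)
  interpret j: ring_hom_cring S T j by fact
  have d: "\<delta> \<in> linear_endos S K" and e: "\<epsilon> \<in> linear_endos T L" using Suc.prems by auto
  have x: "x \<in> carrier S" by fact
  note dc = linear_endosD(2)[OF d] and ec = linear_endosD(2)[OF e]
  obtain g r where g: "g \<in> carrier R" "r \<in> carrier R" "h g \<in> Units S" "h g \<otimes>\<^bsub>S\<^esub> x = h r"
    using frac x by blast
  have u: "j (h g) \<in> Units T" using j.hom_Units g(3) .
  \<comment> \<open>The commutators with \<open>h g\<close> and with its image have lower order and
    again agree on the image of \<open>R\<close>, hence at \<open>x\<close>. Their leading terms are
    values at \<open>h r\<close>, which agree by hypothesis; what remains is the claim multiplied by
    a unit.\<close>
  have "commutator T \<epsilon> (j (h g)) (j x) = j (commutator S \<delta> (h g) x)"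
  proof (rule Suc.IH[of "commutator S \<delta> (h g)" "commutator T \<epsilon> (j (h g))"])
    fix r assume r: "r \<in> carrier R"
    then have "\<epsilon> (j (h g) \<otimes>\<^bsub>T\<^esub> j (h r)) = j (\<delta> (h g \<otimes>\<^bsub>S\<^esub> h r))"
      using Suc.prems(3)[of "g \<otimes> r"] g by simp
    then show "commutator T \<epsilon> (j (h g)) (j (h r)) = j (commutator S \<delta> (h g) (h r))"
      using Suc.prems(3)[OF r] r g dc
      by (simp add: commutator_apply)
  qed (use Suc.prems g x in auto)
  moreover have "j (h g) \<otimes>\<^bsub>T\<^esub> j x = j (h r)"
    using g(1) x by (simp flip: j.hom_mult g(4))
  ultimately have "j (\<delta> (h r)) \<ominus>\<^bsub>T\<^esub> j (h g) \<otimes>\<^bsub>T\<^esub> \<epsilon> (j x) = j (\<delta> (h r)) \<ominus>\<^bsub>T\<^esub> j (h g) \<otimes>\<^bsub>T\<^esub> j (\<delta> x)"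
    using x dc g(1,2,4) Suc.prems(3)[OF g(2)] by (simp add: commutator_apply)
  moreover have "j (\<delta> (h r)) \<in> carrier T" "j (h g) \<in> carrier T" "\<epsilon> (j x) \<in> carrier T"
    "j (\<delta> x) \<in> carrier T"
    using x dc ec g(1,2) by auto
  ultimately have "j (h g) \<otimes>\<^bsub>T\<^esub> \<epsilon> (j x) = j (h g) \<otimes>\<^bsub>T\<^esub> j (\<delta> x)"
    using j.S.minus_left_cancel by (metis j.S.m_closed)
  then show ?case using j.S.Units_l_cancel[OF u] x dc ec by simp
qed

lemma diff_ops_upto_eq_on_fractions:
  assumes "\<delta> \<in> diff_ops_upto S K n" "\<epsilon> \<in> diff_ops_upto S K n"
    and "\<And>r. r \<in> carrier R \<Longrightarrow> \<delta> (h r) = \<epsilon> (h r)"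
    and "x \<in> carrier S"
  shows "\<delta> x = \<epsilon> x"
proof -
  have "ring_hom_cring S S (\<lambda>x. x)"
    by (intro ring_hom_cring.intro ring_hom_cring_axioms.intro S.cring_axioms ring_hom_memI) auto
  from diff_ops_upto_intertwine[OF this assms(2,1) _ assms(4)] assms(3) show ?thesis by simp
qed

text \<open>If \<open>h g \<otimes> x = h r\<close>, the extension \<open>\<Delta>\<close> of \<open>\<delta>\<close> has to satisfy
  \<open>h (\<delta> r) = \<Delta> (h g \<otimes> x) = h g \<otimes> \<Delta> x \<oplus> E g x\<close>, where \<open>E g\<close> extends \<open>[\<delta>, g]\<close>, which has lower
  order. This determines \<open>\<Delta> x\<close>, and independence of \<open>g\<close> and \<open>r\<close> amounts to
  \<open>[E g, k] = [E k, g]\<close>.\<close>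

lemma diff_ops_upto_extend:
  assumes K: "K \<subseteq> carrier R"
  shows "\<delta> \<in> diff_ops_upto R K n \<Longrightarrow>
    \<exists>\<delta>' \<in> diff_ops_upto S (h ` K) n. \<forall>r \<in> carrier R. \<delta>' (h r) = h (\<delta> r)"
proof (induction n arbitrary: \<delta>)
  case 0
  then have d: "\<delta> \<in> linear_endos R (carrier R)" by simp
  \<comment> \<open>An operator of order zero is multiplication by its value at
    \<open>\<one>\<close>, so it extends as multiplication by the image of that value.\<close>
  have "\<delta> r = \<delta> \<one> \<otimes> r" if "r \<in> carrier R" for r
    using linear_endosD(4)[OF d that, of \<one>] linear_endosD(2)[OF d] that by (simp add: R.m_comm)
  then have "h (\<delta> \<one>) \<otimes>\<^bsub>S\<^esub> h r = h (\<delta> r)" if "r \<in> carrier R" for r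
    using that linear_endosD(2)[OF d] hom_mult R.one_closed by metis
  then have "\<forall>r \<in> carrier R. (\<lambda>x \<in> carrier S. h (\<delta> \<one>) \<otimes>\<^bsub>S\<^esub> x) (h r) = h (\<delta> r)" by simp
  moreover have "(\<lambda>x \<in> carrier S. h (\<delta> \<one>) \<otimes>\<^bsub>S\<^esub> x) \<in> linear_endos S (carrier S)"
    using linear_endosD(2)[OF d] by (auto simp: linear_endos_def S.r_distr S.m_lcomm)
  ultimately show ?case unfolding diff_ops_upto.simps by (rule bexI)
next
  case (Suc n)
  then have d: "\<delta> \<in> linear_endos R K" by simp
  note dc = linear_endosD(2)[OF d]
  have hK: "h ` K \<subseteq> carrier S" using K by auto
  \<comment> \<open>The extensions \<open>E g\<close> of the commutators are chosen independently
    for each \<open>g\<close>; the relations between them come from uniqueness.\<close>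
  have "\<forall>g \<in> carrier R. \<exists>e. e \<in> diff_ops_upto S (h ` K) n \<and>
      (\<forall>r \<in> carrier R. e (h r) = h (commutator R \<delta> g r))"
    using Suc by (simp add: Bex_def)
  then obtain E where E: "\<And>g. g \<in> carrier R \<Longrightarrow> E g \<in> diff_ops_upto S (h ` K) n"
    "\<And>g r. g \<in> carrier R \<Longrightarrow> r \<in> carrier R \<Longrightarrow> E g (h r) = h (\<delta> (g \<otimes> r)) \<ominus>\<^bsub>S\<^esub> h g \<otimes>\<^bsub>S\<^esub> h (\<delta> r)"
    using dc by (auto simp: bchoice_iff commutator_apply hom_sub)
  have Ec: "E g x \<in> carrier S" if "g \<in> carrier R" "x \<in> carrier S" for g x
    using S.diff_ops_upto_closed[OF E(1)] that by blast
  have El: "E g \<in> linear_endos S (h ` K)" if "g \<in> carrier R" for g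
    using S.diff_ops_upto_linear[OF E(1) hK] that by blast

  have comm: "E g (h k \<otimes>\<^bsub>S\<^esub> x) \<ominus>\<^bsub>S\<^esub> h k \<otimes>\<^bsub>S\<^esub> E g x = E k (h g \<otimes>\<^bsub>S\<^esub> x) \<ominus>\<^bsub>S\<^esub> h g \<otimes>\<^bsub>S\<^esub> E k x"
    if g: "g \<in> carrier R" and k: "k \<in> carrier R" and x: "x \<in> carrier S" for g k x
  proof -
    \<comment> \<open>Viewing \<open>E g\<close> as an operator of order \<open>Suc n\<close> makes
      its commutators of order \<open>n\<close>, which also covers n = 0.\<close>
    have mem: "commutator S (E g) (h k) \<in> diff_ops_upto S (h ` K) n"
      if "g \<in> carrier R" "k \<in> carrier R" for g k
      using E(1) that S.diff_ops_upto_Suc[OF hK, of n] by auto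
    have "commutator S (E g) (h k) x = commutator S (E k) (h g) x"
    proof (rule diff_ops_upto_eq_on_fractions[OF mem[OF g k] mem[OF k g] _ x])
      fix r assume r: "r \<in> carrier R"
      \<comment> \<open>On the image of \<open>R\<close> the iterated commutator expands into values
        of \<open>\<delta>\<close>, and the expansion is symmetric in \<open>g\<close> and
        \<open>k\<close>.\<close>
      have *: "commutator S (E g) (h k) (h r) = h (\<delta> (g \<otimes> (k \<otimes> r))) \<ominus>\<^bsub>S\<^esub> h g \<otimes>\<^bsub>S\<^esub> h (\<delta> (k \<otimes> r))
            \<ominus>\<^bsub>S\<^esub> h k \<otimes>\<^bsub>S\<^esub> (h (\<delta> (g \<otimes> r)) \<ominus>\<^bsub>S\<^esub> h g \<otimes>\<^bsub>S\<^esub> h (\<delta> r))"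
        if "g \<in> carrier R" "k \<in> carrier R" for g k
        using that r E(2)[of g "k \<otimes> r"] E(2)[of g r] by (simp add: commutator_apply)
      have c: "h (\<delta> (g \<otimes> (k \<otimes> r))) \<in> carrier S" "h (\<delta> (k \<otimes> r)) \<in> carrier S" "h (\<delta> (g \<otimes> r)) \<in> carrier S"
        "h (\<delta> r) \<in> carrier S" "h g \<in> carrier S" "h k \<in> carrier S"
        using r g k dc by auto
      have gk: "g \<otimes> (k \<otimes> r) = k \<otimes> (g \<otimes> r)" using r g k by (simp add: R.m_lcomm)
      show "commutator S (E g) (h k) (h r) = commutator S (E k) (h g) (h r)"
        unfolding *[OF g k] *[OF k g] gk using c unfolding gk by algebra
    qed
    then show ?thesis using x by (simp add: commutator_apply)
  qed

  \<comment> \<open>The map \<open>h\<close> may have a kernel. An element of the kernel is killed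
    by some \<open>g\<close> that becomes a unit; then \<open>\<delta>\<close> and
    \<open>E g\<close> cannot distinguish \<open>u\<close> from \<open>v\<close> after
    multiplication by \<open>g\<close>, and \<open>h g\<close> can be cancelled.\<close>
  have cong: "h (\<delta> u) = h (\<delta> v)" if u: "u \<in> carrier R" and v: "v \<in> carrier R" and uv: "h u = h v" for u v
  proof -
    have "h (u \<ominus> v) = \<zero>\<^bsub>S\<^esub>" using u v uv by (simp add: hom_sub S.minus_eq S.r_neg)
    then obtain g where g: "g \<in> carrier R" "h g \<in> Units S" "g \<otimes> (u \<ominus> v) = \<zero>"
      using frac_zero u v by (meson R.minus_closed)
    then have "g \<otimes> u = g \<otimes> v"
      using u v by (simp add: R.minus_eq R.r_distr R.r_minus)
        (metis R.m_closed R.minus_equality R.minus_minus R.add.inv_closed R.a_comm)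
    then have "E g (h u) = E g (h v)" "h (\<delta> (g \<otimes> u)) = h (\<delta> (g \<otimes> v))" using uv by simp_all
    then have "h g \<otimes>\<^bsub>S\<^esub> h (\<delta> u) = h g \<otimes>\<^bsub>S\<^esub> h (\<delta> v)"
      using g u v dc by (simp add: E(2) S.minus_left_cancel)
    then show ?thesis using S.Units_l_cancel[OF g(2)] u v dc by simp
  qed

  \<comment> \<open>The value at \<open>x\<close> comes from dividing by one denominator, but it
    must solve the equation for every way of clearing denominators, since additivity and linearity
    are proved by changing the denominator.\<close>
  have "\<exists>y \<in> carrier S. \<forall>k \<in> carrier R. \<forall>s \<in> carrier R. h k \<otimes>\<^bsub>S\<^esub> x = h s \<longrightarrow>
      h k \<otimes>\<^bsub>S\<^esub> y = h (\<delta> s) \<ominus>\<^bsub>S\<^esub> E k x" if x: "x \<in> carrier S" for x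
  proof -
    obtain g r where g: "g \<in> carrier R" "r \<in> carrier R" "h g \<in> Units S" "h g \<otimes>\<^bsub>S\<^esub> x = h r"
      using frac x by blast
    define y where "y = inv\<^bsub>S\<^esub> (h g) \<otimes>\<^bsub>S\<^esub> (h (\<delta> r) \<ominus>\<^bsub>S\<^esub> E g x)"
    have y: "y \<in> carrier S" "h g \<otimes>\<^bsub>S\<^esub> y = h (\<delta> r) \<ominus>\<^bsub>S\<^esub> E g x"
      using g x dc Ec by (simp_all add: y_def flip: S.m_assoc)
    have "h k \<otimes>\<^bsub>S\<^esub> y = h (\<delta> s) \<ominus>\<^bsub>S\<^esub> E k x"
      if k: "k \<in> carrier R" "s \<in> carrier R" "h k \<otimes>\<^bsub>S\<^esub> x = h s" for k s
    proof -
      \<comment> \<open>Cross-multiplication: both sides are the product of \<open>h k\<close>,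
        \<open>h g\<close> and \<open>x\<close>. This gives the two commutators compared by
        \<open>comm\<close> the same leading term.\<close>
      have "h (k \<otimes> r) = h (g \<otimes> s)" using g k x by (simp flip: k(3) g(4) add: S.m_lcomm)
      then have krgs: "h (\<delta> (k \<otimes> r)) = h (\<delta> (g \<otimes> s))" using cong g k by simp
      have "h (\<delta> (g \<otimes> s)) \<ominus>\<^bsub>S\<^esub> h g \<otimes>\<^bsub>S\<^esub> h (\<delta> s) \<ominus>\<^bsub>S\<^esub> h k \<otimes>\<^bsub>S\<^esub> E g x =
          h (\<delta> (g \<otimes> s)) \<ominus>\<^bsub>S\<^esub> h k \<otimes>\<^bsub>S\<^esub> h (\<delta> r) \<ominus>\<^bsub>S\<^esub> h g \<otimes>\<^bsub>S\<^esub> E k x"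
        using comm[OF g(1) k(1) x] g k by (simp add: E(2) krgs)
      \<comment> \<open>\<open>?u\<close> and \<open>?v\<close> are the two sides just shown equal,
        so only \<open>?w\<close> survives.\<close>
      moreover have "h k \<otimes>\<^bsub>S\<^esub> h (\<delta> r) \<ominus>\<^bsub>S\<^esub> h k \<otimes>\<^bsub>S\<^esub> E g x =
          (h (\<delta> (g \<otimes> s)) \<ominus>\<^bsub>S\<^esub> h g \<otimes>\<^bsub>S\<^esub> h (\<delta> s) \<ominus>\<^bsub>S\<^esub> h k \<otimes>\<^bsub>S\<^esub> E g x) \<ominus>\<^bsub>S\<^esub>
          (h (\<delta> (g \<otimes> s)) \<ominus>\<^bsub>S\<^esub> h k \<otimes>\<^bsub>S\<^esub> h (\<delta> r) \<ominus>\<^bsub>S\<^esub> h g \<otimes>\<^bsub>S\<^esub> E k x) \<oplus>\<^bsub>S\<^esub>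
          (h g \<otimes>\<^bsub>S\<^esub> h (\<delta> s) \<ominus>\<^bsub>S\<^esub> h g \<otimes>\<^bsub>S\<^esub> E k x)"
        (is "_ = ?u \<ominus>\<^bsub>S\<^esub> ?v \<oplus>\<^bsub>S\<^esub> ?w")
      proof -
        have "h (\<delta> (g \<otimes> s)) \<in> carrier S" "h (\<delta> s) \<in> carrier S" "h (\<delta> r) \<in> carrier S"
          "h g \<in> carrier S" "h k \<in> carrier S" "E g x \<in> carrier S" "E k x \<in> carrier S"
          using g k x dc Ec by auto
        then show ?thesis by algebra
      qed
      ultimately have "h k \<otimes>\<^bsub>S\<^esub> h (\<delta> r) \<ominus>\<^bsub>S\<^esub> h k \<otimes>\<^bsub>S\<^esub> E g x = h g \<otimes>\<^bsub>S\<^esub> h (\<delta> s) \<ominus>\<^bsub>S\<^esub> h g \<otimes>\<^bsub>S\<^esub> E k x"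
        using g k x dc Ec by (simp add: S.minus_eq S.r_neg)
      moreover have "h g \<otimes>\<^bsub>S\<^esub> (h k \<otimes>\<^bsub>S\<^esub> y) = h k \<otimes>\<^bsub>S\<^esub> (h (\<delta> r) \<ominus>\<^bsub>S\<^esub> E g x)"
        using g k y x by (simp flip: y(2) add: S.m_lcomm)
      ultimately have "h g \<otimes>\<^bsub>S\<^esub> (h k \<otimes>\<^bsub>S\<^esub> y) = h g \<otimes>\<^bsub>S\<^esub> (h (\<delta> s) \<ominus>\<^bsub>S\<^esub> E k x)"
        using g k x dc Ec by (simp add: S.minus_eq S.r_distr S.r_minus)
      then show ?thesis using S.Units_l_cancel[OF g(3)] g k x y dc Ec by simp
    qed
    then show ?thesis using y(1) by blast
  qed
  then obtain \<Delta> where \<Delta>c: "\<And>x. x \<in> carrier S \<Longrightarrow> \<Delta> x \<in> carrier S"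
    and \<Delta>: "\<And>x k s. x \<in> carrier S \<Longrightarrow> k \<in> carrier R \<Longrightarrow> s \<in> carrier R \<Longrightarrow> h k \<otimes>\<^bsub>S\<^esub> x = h s \<Longrightarrow>
      h k \<otimes>\<^bsub>S\<^esub> \<Delta> x = h (\<delta> s) \<ominus>\<^bsub>S\<^esub> E k x"
    by metis
  \<comment> \<open>Denominator \<open>\<one>\<close>: the operator \<open>E \<one>\<close> vanishes
    on the image of \<open>R\<close>, because every commutator with \<open>\<one>\<close> is
    zero.\<close>
  have \<Delta>h: "\<Delta> (h r) = h (\<delta> r)" if r: "r \<in> carrier R" for r
    using \<Delta>[of "h r" \<one> r] E(2)[of \<one> r] \<Delta>c[of "h r"] r dc
    by (simp add: S.minus_eq S.r_neg)
  \<comment> \<open>The commutator of \<open>\<Delta>\<close> with \<open>h r\<close> is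
    \<open>E r\<close>, as the construction intends. After multiplication by a denominator of
    \<open>x\<close>, the term \<open>E g (h r \<otimes> x)\<close> is rewritten through
    \<open>comm\<close>.\<close>
  have \<Delta>r: "\<Delta> (h r \<otimes>\<^bsub>S\<^esub> x) = h r \<otimes>\<^bsub>S\<^esub> \<Delta> x \<oplus>\<^bsub>S\<^esub> E r x"
    if r: "r \<in> carrier R" and x: "x \<in> carrier S" for r x
  proof -
    obtain g s where g: "g \<in> carrier R" "s \<in> carrier R" "h g \<in> Units S" "h g \<otimes>\<^bsub>S\<^esub> x = h s"
      using frac x by blast
    have c: "h (\<delta> (r \<otimes> s)) \<in> carrier S" "h (\<delta> s) \<in> carrier S" "h g \<in> carrier S" "h r \<in> carrier S"
      "E g x \<in> carrier S" "E r x \<in> carrier S" "\<Delta> x \<in> carrier S"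
      using g r x dc Ec \<Delta>c by auto
    have "E g (h r \<otimes>\<^bsub>S\<^esub> x) = h r \<otimes>\<^bsub>S\<^esub> E g x \<oplus>\<^bsub>S\<^esub> (E r (h g \<otimes>\<^bsub>S\<^esub> x) \<ominus>\<^bsub>S\<^esub> h g \<otimes>\<^bsub>S\<^esub> E r x)"
      using comm[OF g(1) r x] g r x Ec by (simp add: S.a_minus_eq_iff)
    also have "E r (h g \<otimes>\<^bsub>S\<^esub> x) = h (\<delta> (r \<otimes> s)) \<ominus>\<^bsub>S\<^esub> h r \<otimes>\<^bsub>S\<^esub> h (\<delta> s)"
      using E(2) r g by simp
    finally have *: "E g (h r \<otimes>\<^bsub>S\<^esub> x) =
      h r \<otimes>\<^bsub>S\<^esub> E g x \<oplus>\<^bsub>S\<^esub> (h (\<delta> (r \<otimes> s)) \<ominus>\<^bsub>S\<^esub> h r \<otimes>\<^bsub>S\<^esub> h (\<delta> s) \<ominus>\<^bsub>S\<^esub> h g \<otimes>\<^bsub>S\<^esub> E r x)" .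
    have "h g \<otimes>\<^bsub>S\<^esub> (h r \<otimes>\<^bsub>S\<^esub> x) = h (r \<otimes> s)" using g r x by (simp add: S.m_lcomm flip: g(4))
    then have "h g \<otimes>\<^bsub>S\<^esub> \<Delta> (h r \<otimes>\<^bsub>S\<^esub> x) = h (\<delta> (r \<otimes> s)) \<ominus>\<^bsub>S\<^esub> E g (h r \<otimes>\<^bsub>S\<^esub> x)"
      using \<Delta> g r x by simp
    also have "\<dots> = h r \<otimes>\<^bsub>S\<^esub> (h (\<delta> s) \<ominus>\<^bsub>S\<^esub> E g x) \<oplus>\<^bsub>S\<^esub> h g \<otimes>\<^bsub>S\<^esub> E r x"
      unfolding * using c by algebra
    also have "h (\<delta> s) \<ominus>\<^bsub>S\<^esub> E g x = h g \<otimes>\<^bsub>S\<^esub> \<Delta> x" using \<Delta>[of x g s] g x by simp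
    also have "h r \<otimes>\<^bsub>S\<^esub> (h g \<otimes>\<^bsub>S\<^esub> \<Delta> x) \<oplus>\<^bsub>S\<^esub> h g \<otimes>\<^bsub>S\<^esub> E r x = h g \<otimes>\<^bsub>S\<^esub> (h r \<otimes>\<^bsub>S\<^esub> \<Delta> x \<oplus>\<^bsub>S\<^esub> E r x)"
      using c by algebra
    finally show ?thesis using S.Units_l_cancel[OF g(3)] c x \<Delta>c by simp
  qed
  have \<Delta>add: "\<Delta> (x \<oplus>\<^bsub>S\<^esub> y) = \<Delta> x \<oplus>\<^bsub>S\<^esub> \<Delta> y" if x: "x \<in> carrier S" and y: "y \<in> carrier S" for x y
  proof -
    obtain g r where g: "g \<in> carrier R" "r \<in> carrier R" "h g \<in> Units S" "h g \<otimes>\<^bsub>S\<^esub> x = h r"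
      using frac x by blast
    obtain k s where k: "k \<in> carrier R" "s \<in> carrier R" "h k \<in> Units S" "h k \<otimes>\<^bsub>S\<^esub> y = h s"
      using frac y by blast
    \<comment> \<open>A common denominator of \<open>x\<close> and \<open>y\<close>.\<close>
    define m where "m = k \<otimes> g"
    have m: "m \<in> carrier R" "h m \<in> Units S" using g k by (auto simp: m_def)
    have mx: "h m \<otimes>\<^bsub>S\<^esub> x = h (k \<otimes> r)" using g k x by (simp add: m_def S.m_assoc)
    have my: "h m \<otimes>\<^bsub>S\<^esub> y = h (g \<otimes> s)"
      using g k y by (simp add: m_def S.m_assoc S.m_lcomm[of "h k"])
    have c: "h (\<delta> (k \<otimes> r)) \<in> carrier S" "h (\<delta> (g \<otimes> s)) \<in> carrier S" "E m x \<in> carrier S" "E m y \<in> carrier S"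
      using g k x y m dc Ec by auto
    have "h m \<otimes>\<^bsub>S\<^esub> (x \<oplus>\<^bsub>S\<^esub> y) = h (k \<otimes> r \<oplus> g \<otimes> s)" using mx my x y m g k by (simp add: S.r_distr)
    then have "h m \<otimes>\<^bsub>S\<^esub> \<Delta> (x \<oplus>\<^bsub>S\<^esub> y) = h (\<delta> (k \<otimes> r \<oplus> g \<otimes> s)) \<ominus>\<^bsub>S\<^esub> E m (x \<oplus>\<^bsub>S\<^esub> y)"
      using \<Delta> m x y g k by simp
    also have "\<dots> = h (\<delta> (k \<otimes> r)) \<oplus>\<^bsub>S\<^esub> h (\<delta> (g \<otimes> s)) \<ominus>\<^bsub>S\<^esub> (E m x \<oplus>\<^bsub>S\<^esub> E m y)"
      using linear_endosD(3)[OF d] linear_endosD(3)[OF El] g k m x y dc by simp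
    also have "\<dots> = (h (\<delta> (k \<otimes> r)) \<ominus>\<^bsub>S\<^esub> E m x) \<oplus>\<^bsub>S\<^esub> (h (\<delta> (g \<otimes> s)) \<ominus>\<^bsub>S\<^esub> E m y)"
      using c by algebra
    also have "\<dots> = h m \<otimes>\<^bsub>S\<^esub> (\<Delta> x \<oplus>\<^bsub>S\<^esub> \<Delta> y)"
      using \<Delta>[OF x m(1) _ mx] \<Delta>[OF y m(1) _ my] m x y \<Delta>c g k by (simp add: S.r_distr)
    finally show ?thesis using S.Units_l_cancel[OF m(2)] x y \<Delta>c by simp
  qed
  have \<Delta>K: "\<Delta> (h a \<otimes>\<^bsub>S\<^esub> x) = h a \<otimes>\<^bsub>S\<^esub> \<Delta> x" if a: "a \<in> K" and x: "x \<in> carrier S" for a x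
  proof -
    have aR: "a \<in> carrier R" using a K by blast
    obtain g r where g: "g \<in> carrier R" "r \<in> carrier R" "h g \<in> Units S" "h g \<otimes>\<^bsub>S\<^esub> x = h r"
      using frac x by blast
    have "h g \<otimes>\<^bsub>S\<^esub> (h a \<otimes>\<^bsub>S\<^esub> x) = h (a \<otimes> r)" using g aR x by (simp add: S.m_lcomm flip: g(4))
    then have "h g \<otimes>\<^bsub>S\<^esub> \<Delta> (h a \<otimes>\<^bsub>S\<^esub> x) = h (\<delta> (a \<otimes> r)) \<ominus>\<^bsub>S\<^esub> E g (h a \<otimes>\<^bsub>S\<^esub> x)"
      using \<Delta> g aR x by simp
    also have "\<dots> = h a \<otimes>\<^bsub>S\<^esub> h (\<delta> r) \<ominus>\<^bsub>S\<^esub> h a \<otimes>\<^bsub>S\<^esub> E g x"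
      using linear_endosD(4)[OF d a] linear_endosD(4)[OF El, of g "h a" x] a aR g x dc by simp
    also have "\<dots> = h a \<otimes>\<^bsub>S\<^esub> (h (\<delta> r) \<ominus>\<^bsub>S\<^esub> E g x)"
      using aR g x dc Ec by (simp add: S.minus_eq S.r_distr S.r_minus)
    also have "\<dots> = h g \<otimes>\<^bsub>S\<^esub> (h a \<otimes>\<^bsub>S\<^esub> \<Delta> x)"
      using \<Delta>[of x g r] g x aR \<Delta>c by (simp add: S.m_lcomm flip: \<Delta>[of x g r])
    finally show ?thesis using S.Units_l_cancel[OF g(3)] x aR \<Delta>c by simp
  qed
  have lin: "restrict \<Delta> (carrier S) \<in> linear_endos S (h ` K)"
    using \<Delta>c \<Delta>add \<Delta>K hK by (auto simp: linear_endos_def)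
  have "commutator S (restrict \<Delta> (carrier S)) x \<in> diff_ops_upto S (h ` K) n" if x: "x \<in> carrier S" for x
  proof -
    obtain g r where g: "g \<in> carrier R" "r \<in> carrier R" "h g \<in> Units S" "h g \<otimes>\<^bsub>S\<^esub> x = h r"
      using frac x by blast
    \<comment> \<open>Write x as h r / h g. Applying \<open>\<Delta>r\<close> to both sides of h g
      (x y) = h r y gives that the commutator with x is y |-> (E r y - E g (x y)) / h g. This is
      built from operators of order \<open>n\<close> by operations that preserve the order.\<close>
    have "commutator S (restrict \<Delta> (carrier S)) x =
      (\<lambda>y \<in> carrier S. inv\<^bsub>S\<^esub> (h g) \<otimes>\<^bsub>S\<^esub>
        (\<lambda>y \<in> carrier S. E r y \<ominus>\<^bsub>S\<^esub> (\<lambda>y \<in> carrier S. E g (x \<otimes>\<^bsub>S\<^esub> y)) y) y)"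
      unfolding commutator_def
    proof (rule restrict_ext)
      fix y assume y: "y \<in> carrier S"
      have c: "\<Delta> (x \<otimes>\<^bsub>S\<^esub> y) \<in> carrier S" "\<Delta> y \<in> carrier S" "E r y \<in> carrier S" "h g \<in> carrier S"
        "E g (x \<otimes>\<^bsub>S\<^esub> y) \<in> carrier S" "h r \<in> carrier S"
        using x y g \<Delta>c Ec by auto
      have "h g \<otimes>\<^bsub>S\<^esub> (x \<otimes>\<^bsub>S\<^esub> y) = h r \<otimes>\<^bsub>S\<^esub> y" using x y g by (simp flip: g(4) add: S.m_assoc)
      then have "h g \<otimes>\<^bsub>S\<^esub> \<Delta> (x \<otimes>\<^bsub>S\<^esub> y) \<oplus>\<^bsub>S\<^esub> E g (x \<otimes>\<^bsub>S\<^esub> y) = h r \<otimes>\<^bsub>S\<^esub> \<Delta> y \<oplus>\<^bsub>S\<^esub> E r y"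
        using \<Delta>r[OF g(1), of "x \<otimes>\<^bsub>S\<^esub> y"] \<Delta>r[OF g(2) y] x y by simp
      then have "(h g \<otimes>\<^bsub>S\<^esub> \<Delta> (x \<otimes>\<^bsub>S\<^esub> y) \<oplus>\<^bsub>S\<^esub> E g (x \<otimes>\<^bsub>S\<^esub> y)) \<ominus>\<^bsub>S\<^esub> E g (x \<otimes>\<^bsub>S\<^esub> y) \<ominus>\<^bsub>S\<^esub> h r \<otimes>\<^bsub>S\<^esub> \<Delta> y =
          (h r \<otimes>\<^bsub>S\<^esub> \<Delta> y \<oplus>\<^bsub>S\<^esub> E r y) \<ominus>\<^bsub>S\<^esub> E g (x \<otimes>\<^bsub>S\<^esub> y) \<ominus>\<^bsub>S\<^esub> h r \<otimes>\<^bsub>S\<^esub> \<Delta> y"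
        by simp
      moreover have "(h g \<otimes>\<^bsub>S\<^esub> \<Delta> (x \<otimes>\<^bsub>S\<^esub> y) \<oplus>\<^bsub>S\<^esub> E g (x \<otimes>\<^bsub>S\<^esub> y)) \<ominus>\<^bsub>S\<^esub> E g (x \<otimes>\<^bsub>S\<^esub> y) \<ominus>\<^bsub>S\<^esub> h r \<otimes>\<^bsub>S\<^esub> \<Delta> y =
          h g \<otimes>\<^bsub>S\<^esub> (\<Delta> (x \<otimes>\<^bsub>S\<^esub> y) \<ominus>\<^bsub>S\<^esub> x \<otimes>\<^bsub>S\<^esub> \<Delta> y)"
        unfolding g(4)[symmetric] using c x by algebra
      moreover have "(h r \<otimes>\<^bsub>S\<^esub> \<Delta> y \<oplus>\<^bsub>S\<^esub> E r y) \<ominus>\<^bsub>S\<^esub> E g (x \<otimes>\<^bsub>S\<^esub> y) \<ominus>\<^bsub>S\<^esub> h r \<otimes>\<^bsub>S\<^esub> \<Delta> y = E r y \<ominus>\<^bsub>S\<^esub> E g (x \<otimes>\<^bsub>S\<^esub> y)"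
        using c by algebra
      ultimately have *: "h g \<otimes>\<^bsub>S\<^esub> (\<Delta> (x \<otimes>\<^bsub>S\<^esub> y) \<ominus>\<^bsub>S\<^esub> x \<otimes>\<^bsub>S\<^esub> \<Delta> y) = E r y \<ominus>\<^bsub>S\<^esub> E g (x \<otimes>\<^bsub>S\<^esub> y)"
        by simp
      have "inv\<^bsub>S\<^esub> (h g) \<otimes>\<^bsub>S\<^esub> (h g \<otimes>\<^bsub>S\<^esub> (\<Delta> (x \<otimes>\<^bsub>S\<^esub> y) \<ominus>\<^bsub>S\<^esub> x \<otimes>\<^bsub>S\<^esub> \<Delta> y)) = \<Delta> (x \<otimes>\<^bsub>S\<^esub> y) \<ominus>\<^bsub>S\<^esub> x \<otimes>\<^bsub>S\<^esub> \<Delta> y"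
        using g c x by (simp flip: S.m_assoc)
      then show "restrict \<Delta> (carrier S) (x \<otimes>\<^bsub>S\<^esub> y) \<ominus>\<^bsub>S\<^esub> x \<otimes>\<^bsub>S\<^esub> restrict \<Delta> (carrier S) y = inv\<^bsub>S\<^esub> (h g) \<otimes>\<^bsub>S\<^esub>
        (\<lambda>y \<in> carrier S. E r y \<ominus>\<^bsub>S\<^esub> (\<lambda>y \<in> carrier S. E g (x \<otimes>\<^bsub>S\<^esub> y)) y) y"
        unfolding * using x y by simp
    qed
    also have "\<dots> \<in> diff_ops_upto S (h ` K) n"
      using g x E(1) by (intro S.diff_ops_upto_lmult S.diff_ops_upto_minus S.diff_ops_upto_rmult hK) auto
    finally show ?thesis .
  qed
  with lin \<Delta>h show ?case
    by (intro bexI[of _ "restrict \<Delta> (carrier S)"]) (auto simp del: restrict_apply simp add: restrict_apply')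
qed

end

section \<open>Functoriality of localization\<close>

context cring begin

lemma to_loc_pow_Units:
  assumes f: "f \<in> carrier R"
  shows "to_loc R f (f [^] (m::nat)) \<in> Units (localization R f)"
    and "x \<in> carrier R \<Longrightarrow> to_loc R f (f [^] m) \<otimes>\<^bsub>localization R f\<^esub> fraction R f x m = to_loc R f x"
proof -
  interpret L: cring "localization R f" by (rule cring_localization[OF f])
  have one: "\<one>\<^bsub>localization R f\<^esub> = to_loc R f \<one>" by (simp add: localization_def)
  have eq: "to_loc R f (f [^] m) \<otimes>\<^bsub>localization R f\<^esub> fraction R f x m = to_loc R f x"
    if "x \<in> carrier R" for x
    using f that by (auto simp: fraction_mult fraction_eq_iff m_ac)
  show "to_loc R f (f [^] m) \<in> Units (localization R f)"
    using eq[of \<one>] L.m_comm[of "to_loc R f (f [^] m)" "fraction R f \<one> m"] f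
    by (auto simp: Units_def fraction_closed one intro!: bexI[of _ "fraction R f \<one> m"])
  show "x \<in> carrier R \<Longrightarrow> to_loc R f (f [^] m) \<otimes>\<^bsub>localization R f\<^esub> fraction R f x m = to_loc R f x"
    by (rule eq)
qed

text \<open>The denominator \<open>f [^] m\<close> itself clears a fraction, and the extra power of
  \<open>f\<close> in the equivalence of fractions supplies the element that kills a numerator
  becoming zero.\<close>

lemma ring_of_fractions_localization:
  assumes f: "f \<in> carrier R"
  shows "ring_of_fractions R (localization R f) (to_loc R f)"
proof (intro ring_of_fractions.intro ring_hom_cring.intro ring_hom_cring_axioms.intro
    ring_of_fractions_axioms.intro cring_axioms cring_localization[OF f] ring_hom_memI)
  fix x y assume "x \<in> carrier R" "y \<in> carrier R"
  then show "to_loc R f x \<in> carrier (localization R f)"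
    "to_loc R f (x \<otimes> y) = to_loc R f x \<otimes>\<^bsub>localization R f\<^esub> to_loc R f y"
    "to_loc R f (x \<oplus> y) = to_loc R f x \<oplus>\<^bsub>localization R f\<^esub> to_loc R f y"
    using f by (simp_all add: fraction_closed fraction_mult fraction_add)
next
  show "to_loc R f \<one> = \<one>\<^bsub>localization R f\<^esub>" by (simp add: localization_def)
next
  fix x assume "x \<in> carrier (localization R f)"
  then obtain r m where "r \<in> carrier R" "x = fraction R f r m" by (rule fraction_cases)
  then show "\<exists>g \<in> carrier R. \<exists>r \<in> carrier R. to_loc R f g \<in> Units (localization R f) \<and>
      to_loc R f g \<otimes>\<^bsub>localization R f\<^esub> x = to_loc R f r"
    using f to_loc_pow_Units[OF f] by (intro bexI[of _ "f [^] m"] bexI[of _ r]) auto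
next
  fix u assume u: "u \<in> carrier R" "to_loc R f u = \<zero>\<^bsub>localization R f\<^esub>"
  then have "to_loc R f u = to_loc R f \<zero>" by (simp add: localization_def)
  then obtain k :: nat where "f [^] k \<otimes> u = \<zero>" using u(1) f by (auto simp: fraction_eq_iff)
  then show "\<exists>g \<in> carrier R. to_loc R f g \<in> Units (localization R f) \<and> g \<otimes> u = \<zero>"
    using f to_loc_pow_Units(1)[OF f] by (intro bexI[of _ "f [^] k"]) auto
qed

end

text \<open>Additivity and compatibility with \<open>f\<close> and \<open>g\<close> suffice for
  well-definedness, so one construction localizes both the inclusion of a subring and the projection
  back, which need not be multiplicative.\<close>

lemma localization_map:
  assumes P: "cring P" and Q: "cring Q" and f: "f \<in> carrier P" and g: "g \<in> carrier Q"
    and h: "h \<in> carrier P \<rightarrow> carrier Q"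
    and add: "\<And>x y. x \<in> carrier P \<Longrightarrow> y \<in> carrier P \<Longrightarrow> h (x \<oplus>\<^bsub>P\<^esub> y) = h x \<oplus>\<^bsub>Q\<^esub> h y"
    and mult: "\<And>x. x \<in> carrier P \<Longrightarrow> h (f \<otimes>\<^bsub>P\<^esub> x) = g \<otimes>\<^bsub>Q\<^esub> h x"
  obtains H where "H \<in> carrier (localization P f) \<rightarrow> carrier (localization Q g)"
    and "\<And>s m. s \<in> carrier P \<Longrightarrow> H (fraction P f s m) = fraction Q g (h s) m"
    and "\<And>x y. x \<in> carrier (localization P f) \<Longrightarrow> y \<in> carrier (localization P f) \<Longrightarrow>
      H (x \<oplus>\<^bsub>localization P f\<^esub> y) = H x \<oplus>\<^bsub>localization Q g\<^esub> H y"
proof -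
  interpret P: cring P by fact
  interpret Q: cring Q by fact
  have hc: "h x \<in> carrier Q" if "x \<in> carrier P" for x using h that by auto
  have pow: "h (f [^]\<^bsub>P\<^esub> k \<otimes>\<^bsub>P\<^esub> x) = g [^]\<^bsub>Q\<^esub> k \<otimes>\<^bsub>Q\<^esub> h x" if "x \<in> carrier P" for x and k :: nat
    using that
  proof (induction k arbitrary: x)
    case (Suc k)
    then show ?case using f g hc by (simp add: P.m_assoc Q.m_assoc mult)
  qed (use hc in simp)
  have pow': "h (x \<otimes>\<^bsub>P\<^esub> f [^]\<^bsub>P\<^esub> k) = h x \<otimes>\<^bsub>Q\<^esub> g [^]\<^bsub>Q\<^esub> k" if "x \<in> carrier P" for x and k :: nat
    using pow[OF that] that f g hc P.m_comm Q.m_comm by (metis P.nat_pow_closed Q.nat_pow_closed)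
  have wd: "fraction Q g (h s) m = fraction Q g (h s') m'"
    if s: "s \<in> carrier P" "s' \<in> carrier P" and eq: "fraction P f s m = fraction P f s' m'" for s m s' m'
  proof -
    obtain k :: nat where "f [^]\<^bsub>P\<^esub> k \<otimes>\<^bsub>P\<^esub> (s \<otimes>\<^bsub>P\<^esub> f [^]\<^bsub>P\<^esub> m') = f [^]\<^bsub>P\<^esub> k \<otimes>\<^bsub>P\<^esub> (s' \<otimes>\<^bsub>P\<^esub> f [^]\<^bsub>P\<^esub> m)"
      using eq s f by (auto simp: P.fraction_eq_iff)
    then have "h (f [^]\<^bsub>P\<^esub> k \<otimes>\<^bsub>P\<^esub> (s \<otimes>\<^bsub>P\<^esub> f [^]\<^bsub>P\<^esub> m')) = h (f [^]\<^bsub>P\<^esub> k \<otimes>\<^bsub>P\<^esub> (s' \<otimes>\<^bsub>P\<^esub> f [^]\<^bsub>P\<^esub> m))" by simp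
    then show ?thesis using s f g hc by (auto simp: Q.fraction_eq_iff pow pow')
  qed
  \<comment> \<open>The value is read off from a chosen representing pair; by \<open>wd\<close> it
    does not depend on that pair.\<close>
  define H where "H x = (SOME y. \<exists>s m. s \<in> carrier P \<and> x = fraction P f s m \<and> y = fraction Q g (h s) m)" for x
  have H: "H (fraction P f s m) = fraction Q g (h s) m" if "s \<in> carrier P" for s m
    unfolding H_def by (rule some_equality) (use that wd in blast)+
  show thesis
  proof (rule that[OF _ H])
    show "H \<in> carrier (localization P f) \<rightarrow> carrier (localization Q g)"
      using H hc by (auto elim!: P.fraction_cases simp: Q.fraction_closed)
    show "H (x \<oplus>\<^bsub>localization P f\<^esub> y) = H x \<oplus>\<^bsub>localization Q g\<^esub> H y"
      if "x \<in> carrier (localization P f)" "y \<in> carrier (localization P f)" for x y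
      using that f g hc
      by (auto elim!: P.fraction_cases simp: P.fraction_add Q.fraction_add H add pow')
  qed
qed

section \<open>Integer powers of units and their images under homomorphisms\<close>

lemma (in monoid) Units_pow: "x \<in> Units G \<Longrightarrow> x [^] (n::nat) \<in> Units G"
  by (induction n) (simp_all add: Units_m_closed)

lemma (in monoid) Units_int_pow_closed: "x \<in> Units G \<Longrightarrow> x [^] (t::int) \<in> carrier G"
  using Units_pow[of x] Units_closed by (auto simp: int_pow_def2 simp del: pow_nat)

lemma (in ring_hom_cring) hom_int_pow:
  assumes x: "x \<in> Units R"
  shows "h (x [^] (t::int)) = h x [^]\<^bsub>S\<^esub> t"
proof -
  have pow: "h (x [^] n) = h x [^]\<^bsub>S\<^esub> n" for n :: nat
    using x by (induction n) auto
  have "h (inv (x [^] n)) = inv\<^bsub>S\<^esub> (h (x [^] n))" for n :: nat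
  proof (rule sym, rule S.comm_inv_char)
    have u: "x [^] n \<in> Units R" by (rule R.Units_pow[OF x])
    then show "h (x [^] n) \<otimes>\<^bsub>S\<^esub> h (inv (x [^] n)) = \<one>\<^bsub>S\<^esub>"
      using hom_mult[of "x [^] n" "inv (x [^] n)"] R.Units_closed by simp
    show "h (x [^] n) \<in> carrier S" "h (inv (x [^] n)) \<in> carrier S" using u by blast+
  qed
  then show ?thesis by (simp add: int_pow_def2 pow del: pow_nat)
qed

section \<open>Subrings and direct summands\<close>

text \<open>A decomposition \<open>r \<oplus> n\<close> is unique because \<open>R\<close> and
  \<open>N\<close> meet only in zero. The map \<open>\<beta>\<close> picks the component in
  \<open>R\<close>, and it is linear because sums and multiples can be decomposed
  componentwise.\<close>

lemma direct_summand_projection: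
  assumes S: "cring S" and R: "subring R S"
    and ds: "direct_summand (S\<lparr>carrier := R\<rparr>) (overring_module S) R"
  obtains \<beta> where "\<beta> \<in> carrier S \<rightarrow> R"
    and "\<And>x y. x \<in> carrier S \<Longrightarrow> y \<in> carrier S \<Longrightarrow> \<beta> (x \<oplus>\<^bsub>S\<^esub> y) = \<beta> x \<oplus>\<^bsub>S\<^esub> \<beta> y"
    and "\<And>r x. r \<in> R \<Longrightarrow> x \<in> carrier S \<Longrightarrow> \<beta> (r \<otimes>\<^bsub>S\<^esub> x) = r \<otimes>\<^bsub>S\<^esub> \<beta> x"
    and "\<And>r. r \<in> R \<Longrightarrow> \<beta> r = r"
proof -
  interpret S: cring S by fact
  note Rs = subringE[OF R]
  obtain N where N: "submodule N (S\<lparr>carrier := R\<rparr>) (overring_module S)"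
    and int: "R \<inter> N = {\<zero>\<^bsub>S\<^esub>}" and sum: "R <+>\<^bsub>overring_module S\<^esub> N = carrier S"
    using ds by (auto simp: direct_summand_def overring_module_def)
  interpret N: submodule N "S\<lparr>carrier := R\<rparr>" "overring_module S" by (rule N)
  have Nc: "x \<in> carrier S" if "x \<in> N" for x
    using N.subset that by (auto simp: overring_module_def)
  have Nadd: "x \<oplus>\<^bsub>S\<^esub> y \<in> N" if "x \<in> N" "y \<in> N" for x y
    using N.m_closed[OF that] by (simp add: overring_module_def)
  have Nsm: "r \<otimes>\<^bsub>S\<^esub> x \<in> N" if "r \<in> R" "x \<in> N" for r x
    using N.smult_closed[of r x] that by (simp add: overring_module_def)
  have N0: "\<zero>\<^bsub>S\<^esub> \<in> N" using int by auto
  \<comment> \<open>Negation is scaling by \<open>\<ominus> \<one>\<close>, which lies in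
    \<open>R\<close>.\<close>
  have Ninv: "\<ominus>\<^bsub>S\<^esub> x \<in> N" if "x \<in> N" for x
    using Nsm[of "\<ominus>\<^bsub>S\<^esub> \<one>\<^bsub>S\<^esub>" x] Rs Nc[OF that] that by (simp add: S.l_minus)
  have ex: "\<exists>r \<in> R. \<exists>n \<in> N. x = r \<oplus>\<^bsub>S\<^esub> n" if "x \<in> carrier S" for x
    using that unfolding sum[symmetric] by (auto simp: set_add_def set_mult_def overring_module_def)
  have uniq: "r = r'" if r: "r \<in> R" "r' \<in> R" and n: "n \<in> N" "n' \<in> N" and eq: "r \<oplus>\<^bsub>S\<^esub> n = r' \<oplus>\<^bsub>S\<^esub> n'"
    for r r' n n'
  proof -
    have c: "r \<in> carrier S" "r' \<in> carrier S" "n \<in> carrier S" "n' \<in> carrier S"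
      using r n Rs(1) Nc by auto
    have "r \<ominus>\<^bsub>S\<^esub> r' = (r \<oplus>\<^bsub>S\<^esub> n) \<ominus>\<^bsub>S\<^esub> n \<ominus>\<^bsub>S\<^esub> r'" using c by algebra
    also have "\<dots> = n' \<ominus>\<^bsub>S\<^esub> n" unfolding eq using c by algebra
    finally have *: "r \<ominus>\<^bsub>S\<^esub> r' = n' \<ominus>\<^bsub>S\<^esub> n" .
    moreover have "r \<ominus>\<^bsub>S\<^esub> r' \<in> R" using r Rs by (simp add: S.minus_eq)
    moreover have "n' \<ominus>\<^bsub>S\<^esub> n \<in> N" using n Nadd Ninv by (simp add: S.minus_eq)
    ultimately have "r \<ominus>\<^bsub>S\<^esub> r' = \<zero>\<^bsub>S\<^esub>" using int by auto
    then show ?thesis using c by (simp add: S.r_right_minus_eq)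
  qed
  obtain \<beta> where \<beta>: "\<And>x. x \<in> carrier S \<Longrightarrow> \<beta> x \<in> R \<and> (\<exists>n \<in> N. x = \<beta> x \<oplus>\<^bsub>S\<^esub> n)"
    using bchoice[of "carrier S" "\<lambda>x r. r \<in> R \<and> (\<exists>n \<in> N. x = r \<oplus>\<^bsub>S\<^esub> n)"] ex by blast
  have \<beta>I: "\<beta> (r \<oplus>\<^bsub>S\<^esub> n) = r" if r: "r \<in> R" and n: "n \<in> N" for r n
  proof -
    have "r \<oplus>\<^bsub>S\<^esub> n \<in> carrier S" using r n Rs(1) Nc by auto
    from \<beta>[OF this] show ?thesis using uniq r n by metis
  qed
  show thesis
  proof (rule that)
    show "\<beta> \<in> carrier S \<rightarrow> R" using \<beta> by auto
  next
    fix x y assume xy: "x \<in> carrier S" "y \<in> carrier S"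
    obtain n n' where n: "n \<in> N" "x = \<beta> x \<oplus>\<^bsub>S\<^esub> n" "n' \<in> N" "y = \<beta> y \<oplus>\<^bsub>S\<^esub> n'" using \<beta> xy by metis
    have c: "\<beta> x \<in> carrier S" "\<beta> y \<in> carrier S" "n \<in> carrier S" "n' \<in> carrier S"
      using \<beta> xy n Rs(1) Nc by auto
    have "x \<oplus>\<^bsub>S\<^esub> y = (\<beta> x \<oplus>\<^bsub>S\<^esub> n) \<oplus>\<^bsub>S\<^esub> (\<beta> y \<oplus>\<^bsub>S\<^esub> n')" using n by simp
    also have "\<dots> = (\<beta> x \<oplus>\<^bsub>S\<^esub> \<beta> y) \<oplus>\<^bsub>S\<^esub> (n \<oplus>\<^bsub>S\<^esub> n')" using c by algebra
    finally show "\<beta> (x \<oplus>\<^bsub>S\<^esub> y) = \<beta> x \<oplus>\<^bsub>S\<^esub> \<beta> y" using \<beta>I \<beta> xy n Rs Nadd by simp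
  next
    fix r x assume rx: "r \<in> R" "x \<in> carrier S"
    obtain n where n: "n \<in> N" "x = \<beta> x \<oplus>\<^bsub>S\<^esub> n" using \<beta> rx by metis
    have "r \<otimes>\<^bsub>S\<^esub> x = r \<otimes>\<^bsub>S\<^esub> (\<beta> x \<oplus>\<^bsub>S\<^esub> n)" using n by simp
    also have "\<dots> = r \<otimes>\<^bsub>S\<^esub> \<beta> x \<oplus>\<^bsub>S\<^esub> r \<otimes>\<^bsub>S\<^esub> n"
      using rx n \<beta> Rs(1) Nc by (intro S.r_distr) auto
    finally show "\<beta> (r \<otimes>\<^bsub>S\<^esub> x) = r \<otimes>\<^bsub>S\<^esub> \<beta> x" using \<beta>I \<beta> rx n Rs Nsm by simp
  next
    fix r assume "r \<in> R"
    then show "\<beta> r = r" using \<beta>I[of r "\<zero>\<^bsub>S\<^esub>"] N0 Rs(1) by auto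
  qed
qed

section \<open>Subrings as rings, and polynomial values in them\<close>

lemma (in cring) cring_subring:
  assumes "subring H R"
  shows "cring (R\<lparr>carrier := H\<rparr>)"
  using subcring_iff[OF subringE(1)[OF assms]] subcringI'[OF assms] by simp

lemma (in cring) ring_hom_cring_subring:
  assumes "subring H R"
  shows "ring_hom_cring (R\<lparr>carrier := H\<rparr>) R (\<lambda>x. x)"
  using subringE(1)[OF assms]
  by (intro ring_hom_cring.intro ring_hom_cring_axioms.intro cring_axioms cring_subring[OF assms]
      ring_hom_memI) auto

text \<open>A value is a finite sum of coefficients times powers of an integer multiple of
  \<open>\<one>\<close>, all of which lie in \<open>H\<close> and are computed there as in the big
  ring. So b(t) means the same over both rings and, lying in the subring, is fixed by a projection
  onto it.\<close>

lemma (in cring) eval_int_subring: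
  assumes H: "subring H R" and K: "K \<subseteq> H" and b: "b \<in> carrier (poly_ring_over R K)"
  shows "eval_int (R\<lparr>carrier := H\<rparr>) K b t = eval_int R K b t" and "eval_int R K b t \<in> H"
proof -
  let ?H = "R\<lparr>carrier := H\<rparr>" and ?K = "R\<lparr>carrier := K\<rparr>"
  interpret i: ring_hom_cring ?H R "\<lambda>x. x" by (rule ring_hom_cring_subring[OF H])
  have nat: "add_pow ?H n \<one> = add_pow R n \<one>" for n :: nat
    by (simp add: add_pow_def nat_pow_def)
  have natc: "add_pow R n \<one> \<in> H" for n :: nat
    using i.R.add.nat_pow_closed[of \<one> n] subringE(3)[OF H] nat by simp
  have inv: "\<ominus>\<^bsub>?H\<^esub> x = \<ominus> x" if "x \<in> H" for x using i.hom_a_inv[of x] that by simp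
  have int: "add_pow ?H t \<one> = add_pow R t \<one>"
    by (cases "t < 0") (simp_all add: add_pow_int_lt add_pow_int_ge nat natc inv)
  have intc: "add_pow R t \<one> \<in> H"
    using natc subringE(5)[OF H] by (cases "t < 0") (simp_all add: add_pow_int_lt add_pow_int_ge)
  have pow: "x [^]\<^bsub>?H\<^esub> n = x [^] n" for x and n :: nat by (simp add: nat_pow_def)
  have powc: "add_pow R t \<one> [^] n \<in> H" for n :: nat
    using i.R.nat_pow_closed[of "add_pow R t \<one>" n] intc by (simp add: pow)
  have co: "up_ring.coeff (UP ?K) b i \<in> H" for i
    using b K by (auto simp: UP_def up_def)
  let ?s = "\<lambda>i. up_ring.coeff (UP ?K) b i \<otimes> add_pow R t \<one> [^] i"
  have sc: "?s \<in> {..deg ?K b} \<rightarrow> carrier ?H" using co powc subringE(6)[OF H] by auto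
  have fs: "finsum ?H ?s {..deg ?K b} = finsum R ?s {..deg ?K b}"
    using i.hom_finsum[OF sc] by (simp add: comp_def)
  then show "eval_int (R\<lparr>carrier := H\<rparr>) K b t = eval_int R K b t"
    using b by (simp add: eval_int_def eval_def int pow)
  show "eval_int R K b t \<in> H"
    using i.R.finsum_closed[OF sc] b fs by (simp add: eval_int_def eval_def)
qed

section \<open>Passing to and from the overring\<close>

locale subring_localization =
  fixes S :: "('a, 'm) ring_scheme" and R A :: "'a set" and f :: 'a
  assumes S: "cring S" and R: "subring R S" and A: "A \<subseteq> R" and f: "f \<in> R"
begin

abbreviation "P \<equiv> S\<lparr>carrier := R\<rparr>"
abbreviation "PL \<equiv> localization P f"
abbreviation "SL \<equiv> localization S f"

sublocale S: cring S by (rule S)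
sublocale P: cring P by (rule S.cring_subring[OF R])

lemma R_subset: "R \<subseteq> carrier S" by (rule subringE(1)[OF R])
lemma f_carrier: "f \<in> carrier S" "f \<in> carrier P" using f R_subset by auto

sublocale SL: ring_of_fractions S SL "to_loc S f"
  by (rule S.ring_of_fractions_localization[OF f_carrier(1)])
sublocale PL: ring_of_fractions P PL "to_loc P f"
  by (rule P.ring_of_fractions_localization[OF f_carrier(2)])

lemma nat_pow_P: "x [^]\<^bsub>P\<^esub> (n::nat) = x [^]\<^bsub>S\<^esub> n"
  by (simp add: nat_pow_def)

lemma f_Units: "to_loc P f f \<in> Units PL"
  using P.to_loc_pow_Units(1)[OF f_carrier(2), of 1] by (simp only: P.nat_pow_eone[OF f_carrier(2)])

lemma f_pow: "f [^]\<^bsub>S\<^esub> (t::nat) \<in> R"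
  using P.nat_pow_closed[OF f_carrier(2), of t] by (simp add: nat_pow_P)

text \<open>The elements of \<open>PL\<close> and \<open>SL\<close> are classes of different
  equivalence relations, so the inclusion of rings induces an explicit map between them rather than
  a containment.\<close>

lemma inclusion_localized:
  obtains \<iota> where "ring_hom_cring PL SL \<iota>"
    and "\<And>r m. r \<in> R \<Longrightarrow> \<iota> (fraction P f r m) = fraction S f r m"
proof -
  obtain \<iota> where i: "\<iota> \<in> carrier PL \<rightarrow> carrier SL"
    "\<And>s m. s \<in> carrier P \<Longrightarrow> \<iota> (fraction P f s m) = fraction S f s m"
    "\<And>x y. x \<in> carrier PL \<Longrightarrow> y \<in> carrier PL \<Longrightarrow> \<iota> (x \<oplus>\<^bsub>PL\<^esub> y) = \<iota> x \<oplus>\<^bsub>SL\<^esub> \<iota> y"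
    by (rule localization_map[of P S f f "\<lambda>x. x"])
      (use P.cring_axioms S f_carrier R_subset in auto)
  have "ring_hom_cring PL SL \<iota>"
  proof (intro ring_hom_cring.intro ring_hom_cring_axioms.intro ring_hom_memI
      PL.S.cring_axioms SL.S.cring_axioms)
    fix x y assume xy: "x \<in> carrier PL" "y \<in> carrier PL"
    then show "\<iota> x \<in> carrier SL" "\<iota> (x \<oplus>\<^bsub>PL\<^esub> y) = \<iota> x \<oplus>\<^bsub>SL\<^esub> \<iota> y" using i(1,3) by blast+
    obtain r m where x: "r \<in> carrier P" "x = fraction P f r m" using xy(1) by (rule P.fraction_cases)
    obtain s n where y: "s \<in> carrier P" "y = fraction P f s n" using xy(2) by (rule P.fraction_cases)
    have "r \<in> carrier S" "s \<in> carrier S" "r \<otimes>\<^bsub>S\<^esub> s \<in> carrier P"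
      using x y R_subset subringE(6)[OF R] by auto
    then show "\<iota> (x \<otimes>\<^bsub>PL\<^esub> y) = \<iota> x \<otimes>\<^bsub>SL\<^esub> \<iota> y"
      unfolding x(2) y(2) P.fraction_mult[OF f_carrier(2) x(1) y(1)] i(2)[OF x(1)] i(2)[OF y(1)]
      using f_carrier(1) i(2)[of "r \<otimes>\<^bsub>S\<^esub> s" "m + n"] by (simp add: S.fraction_mult)
  next
    show "\<iota> \<one>\<^bsub>PL\<^esub> = \<one>\<^bsub>SL\<^esub>"
      using i(2)[of "\<one>\<^bsub>S\<^esub>" 0] subringE(3)[OF R] PL.hom_one SL.hom_one by simp
  qed
  with i(2) show thesis using that by simp
qed

lemma eval_int_P:
  assumes "b \<in> carrier (poly_ring_over S A)"
  shows "eval_int P A b t = eval_int S A b t" "eval_int S A b t \<in> R"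
  using S.eval_int_subring[OF R A assms] by auto

text \<open>This direction supplies an operator over \<open>R\<close> for the polynomial of
  \<open>S\<close>. Its extension to \<open>PL\<close> is explicit: the given extension on
  \<open>SL\<close>, preceded by \<open>\<iota>\<close> and followed by the localized
  projection.\<close>

lemma functional_equation_project:
  assumes ds: "direct_summand P (overring_module S) R"
    and b: "b \<in> carrier (poly_ring_over S A)"
    and \<delta>: "\<delta> \<in> diff_ops S A" and eq: "functional_equation S A f \<delta> b"
  shows "\<exists>\<delta>' \<in> diff_ops P A. functional_equation P A f \<delta>' b"
proof -
  obtain \<beta> where \<beta>: "\<beta> \<in> carrier S \<rightarrow> R"
    "\<And>x y. x \<in> carrier S \<Longrightarrow> y \<in> carrier S \<Longrightarrow> \<beta> (x \<oplus>\<^bsub>S\<^esub> y) = \<beta> x \<oplus>\<^bsub>S\<^esub> \<beta> y"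
    "\<And>r x. r \<in> R \<Longrightarrow> x \<in> carrier S \<Longrightarrow> \<beta> (r \<otimes>\<^bsub>S\<^esub> x) = r \<otimes>\<^bsub>S\<^esub> \<beta> x"
    "\<And>r. r \<in> R \<Longrightarrow> \<beta> r = r"
    using direct_summand_projection[OF S R ds] by blast
  obtain B where B: "B \<in> carrier SL \<rightarrow> carrier PL"
    "\<And>s m. s \<in> carrier S \<Longrightarrow> B (fraction S f s m) = fraction P f (\<beta> s) m"
    "\<And>x y. x \<in> carrier SL \<Longrightarrow> y \<in> carrier SL \<Longrightarrow> B (x \<oplus>\<^bsub>SL\<^esub> y) = B x \<oplus>\<^bsub>PL\<^esub> B y"
    by (rule localization_map[of S P f f \<beta>]) (use P.cring_axioms S f_carrier f \<beta> in auto)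
  obtain \<iota> where \<iota>: "ring_hom_cring PL SL \<iota>"
    "\<And>r m. r \<in> R \<Longrightarrow> \<iota> (fraction P f r m) = fraction S f r m"
    using inclusion_localized by blast
  interpret \<iota>: ring_hom_cring PL SL \<iota> by (rule \<iota>(1))
  \<comment> \<open>Linearity of \<open>B\<close> along \<open>\<iota>\<close>, in the form used by
    \<open>diff_ops_upto_compose\<close>; at the unit element it makes \<open>B\<close> a left
    inverse of \<open>\<iota>\<close>.\<close>
  have Bi: "B (\<iota> x \<otimes>\<^bsub>SL\<^esub> y) = x \<otimes>\<^bsub>PL\<^esub> B y" if xy: "x \<in> carrier PL" "y \<in> carrier SL" for x y
  proof -
    obtain r m where x: "r \<in> R" "x = fraction P f r m" using xy(1) by (auto elim: P.fraction_cases)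
    obtain s n where y: "s \<in> carrier S" "y = fraction S f s n" using xy(2) by (rule S.fraction_cases)
    have c: "r \<in> carrier S" "\<beta> s \<in> carrier P" "r \<in> carrier P" "r \<otimes>\<^bsub>S\<^esub> s \<in> carrier S"
      using x y R_subset \<beta>(1) by auto
    show ?thesis
      unfolding x(2) y(2) \<iota>(2)[OF x(1)] S.fraction_mult[OF f_carrier(1) c(1) y(1)] B(2)[OF c(4)]
        B(2)[OF y(1)] P.fraction_mult[OF f_carrier(2) c(3,2)] \<beta>(3)[OF x(1) y(1)] by simp
  qed
  have "B \<one>\<^bsub>SL\<^esub> = \<one>\<^bsub>PL\<^esub>"
    using B(2)[of "\<one>\<^bsub>S\<^esub>" 0] \<beta>(4)[of "\<one>\<^bsub>S\<^esub>"] subringE(3)[OF R] PL.hom_one SL.hom_one by simp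
  then have Bi1: "B (\<iota> x) = x" if "x \<in> carrier PL" for x
    using Bi[OF that, of "\<one>\<^bsub>SL\<^esub>"] that by simp

  obtain n where n: "\<delta> \<in> diff_ops_upto S A n" using \<delta> by (auto simp: diff_ops_def)
  obtain \<delta>L where L: "loc_extension S A f \<delta> \<delta>L"
    and neg: "\<And>t::int. t < 0 \<Longrightarrow> \<delta>L (to_loc S f f [^]\<^bsub>SL\<^esub> (t + 1)) =
      to_loc S f (eval_int S A b t) \<otimes>\<^bsub>SL\<^esub> to_loc S f f [^]\<^bsub>SL\<^esub> t"
    and pos: "\<And>t::nat. \<delta> (f [^]\<^bsub>S\<^esub> (t + 1)) = eval_int S A b (int t) \<otimes>\<^bsub>S\<^esub> f [^]\<^bsub>S\<^esub> t"
    using eq by (auto simp: functional_equation_def)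
  obtain k where k: "\<delta>L \<in> diff_ops_upto SL (to_loc S f ` A) k"
    and Lr: "\<And>r. r \<in> carrier S \<Longrightarrow> \<delta>L (to_loc S f r) = to_loc S f (\<delta> r)"
    using L by (auto simp: loc_extension_def diff_ops_def)
  define \<delta>' where "\<delta>' = (\<lambda>x \<in> carrier P. \<beta> (\<delta> x))"
  define \<delta>L' where "\<delta>L' = (\<lambda>x \<in> carrier PL. B (\<delta>L (\<iota> x)))"
  have "\<delta>' \<in> diff_ops_upto P A n"
    unfolding \<delta>'_def
    by (rule diff_ops_upto_compose[where \<sigma> = "\<lambda>x. x" and L = A and \<alpha> = "\<lambda>x. x",
          OF P.cring_axioms S _ _ _ _ _ _ _ _ _ n])
      (use R_subset A \<beta> in auto)
  then have mem: "\<delta>' \<in> diff_ops P A" by (auto simp: diff_ops_def)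
  have "\<delta>L' \<in> diff_ops_upto PL (to_loc P f ` A) k"
    unfolding \<delta>L'_def
    by (rule diff_ops_upto_compose[where \<sigma> = \<iota> and L = "to_loc S f ` A" and \<alpha> = \<iota>,
          OF PL.S.cring_axioms SL.S.cring_axioms _ _ _ _ _ _ _ _ _ k])
      (use A \<iota>(2) B Bi P.fraction_closed in auto)
  then have L': "loc_extension P A f \<delta>' \<delta>L'"
    using Lr R_subset S.diff_ops_upto_closed[OF n] P.fraction_closed
    by (auto simp: loc_extension_def diff_ops_def \<delta>'_def \<delta>L'_def \<iota>(2) B(2) subset_iff)
  have \<iota>pow: "\<iota> (to_loc P f f [^]\<^bsub>PL\<^esub> t) = to_loc S f f [^]\<^bsub>SL\<^esub> t" for t :: int
    using \<iota>.hom_int_pow[OF f_Units] \<iota>(2)[OF f] by simp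
  have powc: "to_loc P f f [^]\<^bsub>PL\<^esub> t \<in> carrier PL" for t :: int
    by (rule PL.S.Units_int_pow_closed[OF f_Units])
  have "functional_equation P A f \<delta>' b"
    unfolding functional_equation_def
  proof (intro conjI allI exI[of _ \<delta>L'] impI L')
    fix t :: nat
    have "f [^]\<^bsub>S\<^esub> t \<in> carrier S" using f_pow R_subset by blast
    then have "\<beta> (eval_int S A b (int t) \<otimes>\<^bsub>S\<^esub> f [^]\<^bsub>S\<^esub> t) = eval_int S A b (int t) \<otimes>\<^bsub>S\<^esub> f [^]\<^bsub>S\<^esub> t"
      using \<beta>(3)[OF eval_int_P(2)[OF b]] \<beta>(4)[OF f_pow] by simp
    then show "\<delta>' (f [^]\<^bsub>P\<^esub> (t + 1)) = eval_int P A b (int t) \<otimes>\<^bsub>P\<^esub> f [^]\<^bsub>P\<^esub> t"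
      using f_pow[of "t + 1"] pos[of t] eval_int_P(1)[OF b] unfolding nat_pow_P by (simp add: \<delta>'_def)
  next
    fix t :: int assume t: "t < 0"
    have e: "eval_int S A b t \<in> R" by (rule eval_int_P(2)[OF b])
    have ec: "to_loc P f (eval_int S A b t) \<in> carrier PL" using e by (intro PL.hom_closed) simp
    \<comment> \<open>Both factors of the right-hand side over \<open>SL\<close> are images under
      \<open>\<iota>\<close>, so \<open>B\<close> returns the same product in
      \<open>PL\<close>.\<close>
    have "\<delta>L' (to_loc P f f [^]\<^bsub>PL\<^esub> (t + 1)) = B (\<delta>L (\<iota> (to_loc P f f [^]\<^bsub>PL\<^esub> (t + 1))))"
      using powc unfolding \<delta>L'_def by (rule restrict_apply')
    also have "\<delta>L (\<iota> (to_loc P f f [^]\<^bsub>PL\<^esub> (t + 1))) =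
        \<iota> (to_loc P f (eval_int S A b t)) \<otimes>\<^bsub>SL\<^esub> \<iota> (to_loc P f f [^]\<^bsub>PL\<^esub> t)"
      unfolding \<iota>pow neg[OF t] \<iota>(2)[OF e] ..
    also have "\<dots> = \<iota> (to_loc P f (eval_int S A b t) \<otimes>\<^bsub>PL\<^esub> to_loc P f f [^]\<^bsub>PL\<^esub> t)"
      using ec powc by (rule \<iota>.hom_mult[symmetric])
    also have "B \<dots> = to_loc P f (eval_int S A b t) \<otimes>\<^bsub>PL\<^esub> to_loc P f f [^]\<^bsub>PL\<^esub> t"
      using ec powc by (intro Bi1 PL.S.m_closed)
    finally show "\<delta>L' (to_loc P f f [^]\<^bsub>PL\<^esub> (t + 1)) =
      to_loc P f (eval_int P A b t) \<otimes>\<^bsub>PL\<^esub> to_loc P f f [^]\<^bsub>PL\<^esub> t"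
      unfolding eval_int_P(1)[OF b] .
  qed
  with mem show ?thesis by blast
qed

text \<open>This direction gives minimality: a polynomial with a functional equation over
  \<open>R\<close> has one over \<open>S\<close>, hence is divisible by the polynomial of
  \<open>S\<close>. Differential extensibility speaks only of \<open>R\<close> and \<open>S\<close>,
  so the operator on \<open>SL\<close> is built by \<open>diff_ops_upto_extend\<close> and then
  compared with the given one on \<open>PL\<close>.\<close>

lemma functional_equation_extend:
  assumes de: "differentially_extensible S R A"
    and b: "b \<in> carrier (poly_ring_over S A)"
    and \<delta>: "\<delta> \<in> diff_ops P A" and eq: "functional_equation P A f \<delta> b"
  shows "\<exists>\<delta>' \<in> diff_ops S A. functional_equation S A f \<delta>' b"
proof -
  obtain \<delta>' where \<delta>': "\<delta>' \<in> diff_ops S A" "restrict \<delta>' R = \<delta>"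
    using de \<delta> by (auto simp: differentially_extensible_def)
  have res: "\<delta>' r = \<delta> r" if "r \<in> R" for r using that by (simp flip: \<delta>'(2))
  obtain \<iota> where \<iota>: "ring_hom_cring PL SL \<iota>"
    "\<And>r m. r \<in> R \<Longrightarrow> \<iota> (fraction P f r m) = fraction S f r m"
    using inclusion_localized by blast
  interpret \<iota>: ring_hom_cring PL SL \<iota> by (rule \<iota>(1))
  have AS: "A \<subseteq> carrier S" using A R_subset by blast
  obtain n where n: "\<delta>' \<in> diff_ops_upto S A n" using \<delta>' by (auto simp: diff_ops_def)
  from SL.diff_ops_upto_extend[OF AS n] obtain E where
    E: "E \<in> diff_ops_upto SL (to_loc S f ` A) n"
    "\<And>r. r \<in> carrier S \<Longrightarrow> E (to_loc S f r) = to_loc S f (\<delta>' r)" by blast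
  obtain \<delta>L where L: "loc_extension P A f \<delta> \<delta>L"
    and neg: "\<And>t::int. t < 0 \<Longrightarrow> \<delta>L (to_loc P f f [^]\<^bsub>PL\<^esub> (t + 1)) =
      to_loc P f (eval_int P A b t) \<otimes>\<^bsub>PL\<^esub> to_loc P f f [^]\<^bsub>PL\<^esub> t"
    and pos: "\<And>t::nat. \<delta> (f [^]\<^bsub>P\<^esub> (t + 1)) = eval_int P A b (int t) \<otimes>\<^bsub>P\<^esub> f [^]\<^bsub>P\<^esub> t"
    using eq by (auto simp: functional_equation_def)
  obtain k where k: "\<delta>L \<in> diff_ops_upto PL (to_loc P f ` A) k"
    and Lr: "\<And>r. r \<in> R \<Longrightarrow> \<delta>L (to_loc P f r) = to_loc P f (\<delta> r)"
    using L by (auto simp: loc_extension_def diff_ops_def)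
  have \<delta>c: "\<delta> r \<in> R" if "r \<in> R" for r
    using \<delta> P.diff_ops_upto_closed[of \<delta> A _ r] that by (auto simp: diff_ops_def)
  \<comment> \<open>The two composites agree on the image of \<open>R\<close> because
    \<open>\<delta>'\<close> restricts to \<open>\<delta>\<close>; intertwining carries this over to
    fractions once both operators are given a common order.\<close>
  have E\<iota>: "E (\<iota> x) = \<iota> (\<delta>L x)" if x: "x \<in> carrier PL" for x
  proof (rule PL.diff_ops_upto_intertwine[OF \<iota>(1) _ _ _ x])
    have "to_loc P f ` A \<subseteq> carrier PL" "to_loc S f ` A \<subseteq> carrier SL"
      using A AS P.fraction_closed S.fraction_closed by auto
    then show "\<delta>L \<in> diff_ops_upto PL (to_loc P f ` A) (max k n)"
      "E \<in> diff_ops_upto SL (to_loc S f ` A) (max k n)"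
      using PL.S.diff_ops_upto_mono[of _ k "max k n"] SL.S.diff_ops_upto_mono[of _ n "max k n"] k E(1)
      by (meson max.cobounded1 max.cobounded2 subsetD)+
    fix r assume "r \<in> carrier P"
    then have r: "r \<in> R" "r \<in> carrier S" using R_subset by auto
    show "E (\<iota> (to_loc P f r)) = \<iota> (\<delta>L (to_loc P f r))"
      unfolding \<iota>(2)[OF r(1)] E(2)[OF r(2)] Lr[OF r(1)] \<iota>(2)[OF \<delta>c[OF r(1)]] res[OF r(1)] ..
  qed
  have \<iota>pow: "\<iota> (to_loc P f f [^]\<^bsub>PL\<^esub> t) = to_loc S f f [^]\<^bsub>SL\<^esub> t" for t :: int
    using \<iota>.hom_int_pow[OF f_Units] \<iota>(2)[OF f] by simp
  have powc: "to_loc P f f [^]\<^bsub>PL\<^esub> t \<in> carrier PL" for t :: int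
    by (rule PL.S.Units_int_pow_closed[OF f_Units])
  have "functional_equation S A f \<delta>' b"
    unfolding functional_equation_def
  proof (intro conjI allI exI[of _ E] impI)
    show "loc_extension S A f \<delta>' E" using E by (auto simp: loc_extension_def diff_ops_def)
  next
    fix t :: nat
    show "\<delta>' (f [^]\<^bsub>S\<^esub> (t + 1)) = eval_int S A b (int t) \<otimes>\<^bsub>S\<^esub> f [^]\<^bsub>S\<^esub> t"
      using pos[of t] unfolding nat_pow_P eval_int_P(1)[OF b] res[OF f_pow] by simp
  next
    fix t :: int assume t: "t < 0"
    have e: "eval_int S A b t \<in> R" by (rule eval_int_P(2)[OF b])
    have "E (to_loc S f f [^]\<^bsub>SL\<^esub> (t + 1)) = \<iota> (\<delta>L (to_loc P f f [^]\<^bsub>PL\<^esub> (t + 1)))"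
      by (simp only: E\<iota>[OF powc, symmetric] \<iota>pow)
    also have "\<dots> = \<iota> (to_loc P f (eval_int S A b t)) \<otimes>\<^bsub>SL\<^esub> \<iota> (to_loc P f f [^]\<^bsub>PL\<^esub> t)"
      unfolding neg[OF t] eval_int_P(1)[OF b] using e powc by (intro \<iota>.hom_mult PL.hom_closed) simp_all
    finally show "E (to_loc S f f [^]\<^bsub>SL\<^esub> (t + 1)) =
      to_loc S f (eval_int S A b t) \<otimes>\<^bsub>SL\<^esub> to_loc S f f [^]\<^bsub>SL\<^esub> t"
      unfolding \<iota>pow \<iota>(2)[OF e] .
  qed
  with \<delta>'(1) show ?thesis by blast
qed

end

theorem theorem6p11:
  fixes S :: "('a, 'm) ring_scheme" and R A :: "'a set" and f :: 'a
  assumes "cring S"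
    and "subring R S"
    and "subring A S"
    and "A \<subseteq> R"
    and "f \<in> R"
    and "direct_summand (S\<lparr>carrier := R\<rparr>) (overring_module S) R"
    and "differentially_extensible S R A"
    and "has_bernstein_sato S A f"
  shows "has_bernstein_sato (S\<lparr>carrier := R\<rparr>) A f \<and>
    bernstein_sato_poly (S\<lparr>carrier := R\<rparr>) A f = bernstein_sato_poly S A f"
proof -
  interpret subring_localization S R A f
    using assms by (intro subring_localization.intro)
  obtain b where b: "is_bernstein_sato S A f b" using assms(8) by (auto simp: has_bernstein_sato_def)
  then have bc: "b \<in> carrier (poly_ring_over S A)" by (simp add: is_bernstein_sato_def monic_poly_def)
  \<comment> \<open>Uniqueness of the polynomial over \<open>P\<close> asks for \<open>A\<close> as
    a subring of \<open>P\<close>.\<close>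
  have AP: "subring A P"
    using P.ring_incl_imp_subring[of A] S.subring_is_ring[OF assms(3)] A by simp
  \<comment> \<open>The coefficients lie in \<open>A\<close> either way, so the polynomial rings
    over \<open>P\<close> and \<open>S\<close> simplify to the same ring, and monicity and
    divisibility carry over. Projection gives existence, extension gives minimality.\<close>
  have "is_bernstein_sato P A f b"
    using b functional_equation_project[OF assms(6) bc] functional_equation_extend[OF assms(7)]
    unfolding is_bernstein_sato_def monic_poly_def by simp blast
  \<comment> \<open>Uniqueness over each ring evaluates both definite descriptions to
    \<open>b\<close>.\<close>
  then show ?thesis
    using b is_bernstein_sato_unique[OF assms(1,3)] is_bernstein_sato_unique[OF P.cring_axioms AP]
    unfolding has_bernstein_sato_def bernstein_sato_poly_def by (metis (no_types, lifting) the_equality)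
qed

end
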